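(* Let $S_t=S_0e^{X_t}$, $S_0>0$, be an exponential Lévy model where $(X_t)$ has triplet $(\sigma^2,b,\nu)$ satisfying the standing assumptions in the context. For $k>0$, let $V(t,k)$ be the (dimensionless) implied variance at log-moneyness $k$ and maturity $t$, and let $a_0(k)=\int_{-\infty}^\infty(e^x-e^k)_+\,\nu(dx)$. Then $$V(t,k)=V_0(t,k)\Big[1+V_1(t,k)+o\Big(\frac1{\log\frac1t}\Big)\Big]\qquad(t\to0),$$ where $$V_0(t,k)=\frac{\frac12k^2}{\log(\frac1t)},\qquad V_1(t,k)=\frac1{\log(\frac1t)}\log\left[\frac{4\sqrt\pi\,a_0(k)\,e^{-k/2}}{k}\Big[\log\Big(\frac1t\Big)\Big]^{3/2}\right].$$
   Context: Triplet convention: $\mathbb{E}e^{iuX_t}=\exp\{t(ibu-\tfrac12\sigma^2u^2+\int(e^{iux}-1-iux1_{|x|\le1})\nu(dx))\}$. Standing assumptions: zero interest rate and dividends; $\int_{|x|>1}e^x\nu(dx)<\infty$; the martingale condition $b+\tfrac12\sigma^2+\int_{-\infty}^\infty(e^x-1-x1_{|x|\le1})\nu(dx)=0$; $\nu(dx)$ has a positive density $\nu(x)$ which is $C^1$ on $\mathbb{R}\setminus\{0\}$ with $\sup_{|x|>\varepsilon}\nu(x)<\infty$ for every $\varepsilon>0$. Implied variance: $V(t,k)=\hat\sigma_t(k)^2t$, where $\hat\sigma_t(k)$ is the Black–Scholes implied volatility with zero rates; i.e. $V=V(t,k)>0$ is the unique solution of $\frac1{S_0}\mathbb{E}(S_t-S_0e^k)_+=\Phi\big(\tfrac{-k}{\sqrt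 V}+\tfrac{\sqrt V}2\big)-e^k\Phi\big(\tfrac{-k}{\sqrt V}-\tfrac{\sqrt V}2\big)$, with $\Phi$ the standard normal distribution function. *)

theory Defs
  imports "HOL-Probability.Probability" "HOL-Library.Landau_Symbols"
begin

text \<open>The process is indexed by \<^typ>\<open>real\<close>, but only its values at times \<open>t \<ge> 0\<close> are
  constrained. For the increments the grid points may coincide, and the grid may start at 0.\<close>

definition levy_process :: "'a measure \<Rightarrow> (real \<Rightarrow> 'a \<Rightarrow> real) \<Rightarrow> bool" where
  "levy_process M X \<longleftrightarrow>
     prob_space M \<and>
     (\<forall>t\<ge>0. X t \<in> borel_measurable M) \<and>
     (AE \<omega> in M. X 0 \<omega> = 0) \<and>
     (\<forall>n (\<tau> :: nat \<Rightarrow> real). 0 \<le> \<tau> 0 \<longrightarrow> (\<forall>i<n. \<tau> i \<le> \<tau> (Suc i)) \<longrightarrow>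
        prob_space.indep_vars M (\<lambda>_. borel) (\<lambda>i \<omega>. X (\<tau> (Suc i)) \<omega> - X (\<tau> i) \<omega>) {..<n}) \<and>
     (\<forall>s\<ge>0. \<forall>h\<ge>0. distr M borel (\<lambda>\<omega>. X (s + h) \<omega> - X s \<omega>) = distr M borel (X h)) \<and>
     (\<forall>t\<ge>0. \<forall>\<epsilon>>0.
        ((\<lambda>s. measure M {\<omega> \<in> space M. \<epsilon> < \<bar>X s \<omega> - X t \<omega>\<bar>}) \<longlongrightarrow> 0) (at t within {0..})) \<and>
     (AE \<omega> in M. \<forall>t\<ge>0. continuous (at_right t) (\<lambda>s. X s \<omega>) \<and>
        (0 < t \<longrightarrow> (\<exists>l. ((\<lambda>s. X s \<omega>) \<longlongrightarrow> l) (at_left t))))"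

definition levy_measure :: "real measure \<Rightarrow> bool" where
  "levy_measure \<nu> \<longleftrightarrow>
     sets \<nu> = sets borel \<and> emeasure \<nu> {0} = 0 \<and>
     (\<integral>\<^sup>+x. ennreal (min 1 (x\<^sup>2)) \<partial>\<nu>) < \<infinity>"

text \<open>The triplet is \<open>(\<sigma>\<^sup>2, b, \<nu>)\<close>, with truncation function \<open>x \<mapsto> x 1(\<bar>x\<bar> \<le> 1)\<close>;
  the first parameter below is the Gaussian variance \<open>\<sigma>\<^sup>2\<close>, not \<open>\<sigma>\<close>.\<close>

definition levy_exponent :: "real \<Rightarrow> real \<Rightarrow> real measure \<Rightarrow> real \<Rightarrow> complex" where
  "levy_exponent v b \<nu> u =
     \<i> * of_real (b * u) - of_real (v * u\<^sup>2 / 2)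
     + (CLINT x|\<nu>. iexp (u * x) - 1 - \<i> * of_real (u * x * indicator {-1..1} x))"

definition has_levy_triplet ::
  "'a measure \<Rightarrow> (real \<Rightarrow> 'a \<Rightarrow> real) \<Rightarrow> real \<Rightarrow> real \<Rightarrow> real measure \<Rightarrow> bool" where
  "has_levy_triplet M X v b \<nu> \<longleftrightarrow>
     levy_process M X \<and> 0 \<le> v \<and> levy_measure \<nu> \<and>
     (\<forall>t\<ge>0. \<forall>u. (CLINT \<omega>|M. iexp (u * X t \<omega>)) = exp (of_real t * levy_exponent v b \<nu> u))"

abbreviation Phi :: "real \<Rightarrow> real" where
  "Phi \<equiv> cdf std_normal_distribution"

text \<open>Black--Scholes call price with zero rates, divided by the spot, at log-moneyness \<open>k\<close> and
  dimensionless variance \<open>V\<close> (volatility squared times maturity).\<close>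

definition bs_call :: "real \<Rightarrow> real \<Rightarrow> real" where
  "bs_call k V =
     Phi (- k / sqrt V + sqrt V / 2) - exp k * Phi (- k / sqrt V - sqrt V / 2)"

definition implied_variance ::
  "'a measure \<Rightarrow> real \<Rightarrow> (real \<Rightarrow> 'a \<Rightarrow> real) \<Rightarrow> real \<Rightarrow> real \<Rightarrow> real" where
  "implied_variance M S0 S t k =
     (THE V. 0 < V \<and> 1 / S0 * (LINT \<omega>|M. max (S t \<omega> - S0 * exp k) 0) = bs_call k V)"

definition a0 :: "real measure \<Rightarrow> real \<Rightarrow> real" where
  "a0 \<nu> k = (LINT x|\<nu>. max (exp x - exp k) 0)"

definition V0 :: "real \<Rightarrow> real \<Rightarrow> real" where
  "V0 t k = (1 / 2 * k\<^sup>2) / ln (1 / t)"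

definition V1 :: "real measure \<Rightarrow> real \<Rightarrow> real \<Rightarrow> real" where
  "V1 \<nu> t k =
     1 / ln (1 / t) *
     ln (4 * sqrt pi * a0 \<nu> k * exp (- k / 2) / k * ln (1 / t) powr (3 / 2))"

end

theory Submission
  imports Defs "HOL-Real_Asymp.Real_Asymp"
begin

text \<open>The law of \<open>X t\<close> divided by \<open>t\<close> converges to \<open>\<nu>\<close> away from 0: multiplied by a weight vanishing to
  fourth order at 0 it becomes a finite measure whose Fourier transform is explicit in terms of the
  characteristic exponent, so Levy's continuity theorem applies. Splitting \<open>min (exp x) (exp K) - 1\<close> into
  a trigonometric polynomial and a multiple of the weight gives
  \<open>E min (exp (X t)) (exp K) = 1 - t * a0 \<nu> K + o(t)\<close>. Independent increments with capped jumps turn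
  this into \<open>E exp (X t) = 1\<close>, hence the call price is \<open>a0 \<nu> k * t * (1 + o(1))\<close>. Finally
  \<open>bs_call k V\<close> is asymptotic to \<open>exp (k / 2) / (sqrt (2 * pi) * k\<^sup>2) * V powr (3 / 2) * exp (- k\<^sup>2 / (2 * V))\<close> as
  \<open>V\<close> tends to 0, and taking logarithms inverts the relation up to the required order.\<close>

section \<open>Levy measures and characteristic exponents\<close>

text \<open>The triplet enters only through characteristic functions at real arguments: the law of
  \<open>X t\<close> comes with no decomposition into jumps and with no exponential moment. Hence
  small-time limits are taken on the Fourier side, and \<open>E exp (X t) = 1\<close> has to be
  derived from the condition on the triplet. The weight must vanish faster than \<open>x^2\<close>
  at 0, since a weight of second order would let the Gaussian component survive in the limit as an
  atom at 0. What the weight cannot see, the drift and the Gaussian variance, is carried by sines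
  and a cosine, whose limits are the imaginary and real parts of the exponent. Weak convergence
  handles only bounded functions, so the exponential is capped and the uncapped mass is recovered
  from \<open>E exp (X t) = 1\<close>. A first-order price is enough: a relative error o(1) in the
  price is an additive o(1) in its logarithm, which division by \<open>ln (1 / t)\<close> turns into
  the claimed error.\<close>

lemma sets_levy_measure: "levy_measure \<nu> \<Longrightarrow> sets \<nu> = sets borel"
  by (simp add: levy_measure_def)

lemma integrable_levy_measure_min:
  assumes "levy_measure \<nu>"
  shows "integrable \<nu> (\<lambda>x. min 1 (x\<^sup>2))"
proof -
  note [measurable_cong] = sets_levy_measure[OF assms]
  have "(\<lambda>x. min 1 (x\<^sup>2)) \<in> borel_measurable \<nu>" by measurable
  then show ?thesis
    unfolding integrable_iff_bounded using assms by (auto simp: levy_measure_def)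
qed

lemma integrable_levy_measureI:
  fixes f :: "real \<Rightarrow> 'b::{banach, second_countable_topology}"
  assumes nu: "levy_measure \<nu>" and [measurable]: "f \<in> borel_measurable borel"
    and bound: "\<And>x. norm (f x) \<le> C * min 1 (x\<^sup>2)"
  shows "integrable \<nu> f"
proof (rule Bochner_Integration.integrable_bound)
  show "integrable \<nu> (\<lambda>x. C * min 1 (x\<^sup>2))"
    using integrable_levy_measure_min[OF nu] by simp
  show "f \<in> borel_measurable \<nu>"
    using sets_levy_measure[OF nu] assms(2) by (simp cong: measurable_cong_sets)
  show "AE x in \<nu>. norm (f x) \<le> norm (C * min 1 (x\<^sup>2))"
    using bound by (auto intro!: AE_I2 order_trans[OF bound])
qed

text \<open>Away from 0 the function \<open>min 1 (x^2)\<close> is bounded below, so each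
  \<open>A n\<close> has finite mass, and 0 itself is a null set. The Fubini exchange with the
  Gaussian frequency relies on this.\<close>

lemma sigma_finite_levy_measure:
  assumes nu: "levy_measure \<nu>"
  shows "sigma_finite_measure \<nu>"
proof
  define A where "A n = {x::real. 1 / real (Suc n) < \<bar>x\<bar>}" for n
  have s: "sets \<nu> = sets borel" using nu by (rule sets_levy_measure)
  have sp: "space \<nu> = UNIV" using s by (metis sets_eq_imp_space_eq space_borel)
  have A: "A n \<in> sets borel" for n
    unfolding A_def by measurable
  have fin: "emeasure \<nu> (A n) \<noteq> \<infinity>" for n
  proof -
    have "integrable \<nu> (indicator (A n) :: real \<Rightarrow> real)"
    proof (rule integrable_levy_measureI[OF nu, where C="real (Suc n)^2"])
      show "norm (indicator (A n) x :: real) \<le> real (Suc n)^2 * min 1 (x\<^sup>2)" for x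
      proof (cases "x \<in> A n")
        case True
        then have "1 < real (Suc n) * \<bar>x\<bar>"
          by (simp add: A_def field_simps)
        then have "1 \<le> (real (Suc n) * \<bar>x\<bar>)\<^sup>2"
          by (metis less_imp_le one_le_power)
        moreover have "1 \<le> (real (Suc n))\<^sup>2" by simp
        ultimately show ?thesis using True
          by (auto simp: min_def power_mult_distrib)
      qed auto
    qed (use A in simp)
    then show ?thesis
      using A s by (simp add: integrable_indicator_iff sp less_top)
  qed
  show "\<exists>B. countable B \<and> B \<subseteq> sets \<nu> \<and> \<Union>B = space \<nu> \<and> (\<forall>a\<in>B. emeasure \<nu> a \<noteq> \<infinity>)"
  proof (intro exI conjI)
    show "\<Union>(insert {0} (range A)) = space \<nu>"
    proof -
      have "x \<in> \<Union>(insert {0} (range A))" for x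
      proof (cases "x = 0")
        case False
        then obtain n where "inverse (of_nat (Suc n)) < \<bar>x\<bar>"
          using reals_Archimedean[of "\<bar>x\<bar>"] by auto
        then show ?thesis by (auto simp: A_def inverse_eq_divide)
      qed simp
      then show ?thesis using sp by auto
    qed
  qed (use A fin s nu in \<open>auto simp: levy_measure_def\<close>)
qed

definition levy_integrand :: "real \<Rightarrow> real \<Rightarrow> complex" where
  "levy_integrand u x = iexp (u * x) - 1 - \<i> * of_real (u * x * indicator {-1..1} x)"

lemma levy_integrand_measurable [measurable]:
  "(\<lambda>(u, x). levy_integrand u x) \<in> borel_measurable (borel \<Otimes>\<^sub>M borel)"
  unfolding levy_integrand_def by measurable

text \<open>Taylor expansion for small \<open>x\<close>, the trivial bound 2 for large
  \<open>x\<close>. Growth that is only quadratic in \<open>u\<close> makes the bound integrable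
  when \<open>u\<close> is shifted by a Gaussian variable.\<close>

lemma norm_levy_integrand_le: "cmod (levy_integrand u x) \<le> (2 + u\<^sup>2) * min 1 (x\<^sup>2)"
proof (cases "\<bar>x\<bar> \<le> 1")
  case True
  have "cmod (levy_integrand u x) \<le> \<bar>u * x\<bar>\<^sup>2 / 2"
    using iexp_approx1[of "u * x" 1] True
    by (simp add: levy_integrand_def indicator_def abs_le_iff algebra_simps numeral_2_eq_2)
  also have "\<dots> \<le> (2 + u\<^sup>2) * x\<^sup>2"
  proof -
    have "0 \<le> 2 * x\<^sup>2 + u\<^sup>2 * x\<^sup>2 / 2" by simp
    then show ?thesis by (simp add: power_mult_distrib algebra_simps)
  qed
  also have "x\<^sup>2 = min 1 (x\<^sup>2)"
    using True by (simp add: abs_square_le_1)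
  finally show ?thesis .
next
  case False
  then have "1 < x\<^sup>2"
    by (metis abs_ge_zero not_le one_less_power pos2 power2_abs)
  moreover have "cmod (levy_integrand u x) \<le> 2"
    using False norm_triangle_ineq4[of "iexp (u * x)" 1]
    by (auto simp: levy_integrand_def indicator_def abs_le_iff)
  ultimately have "cmod (levy_integrand u x) \<le> 2 + u\<^sup>2" "min 1 (x\<^sup>2) = 1"
    using zero_le_power2[of u] by linarith+
  then show ?thesis by simp
qed

lemma integrable_levy_integrand:
  assumes "levy_measure \<nu>"
  shows "integrable \<nu> (levy_integrand u)"
  using norm_levy_integrand_le by (intro integrable_levy_measureI[OF assms]) auto

lemma levy_exponent_eq:
  "levy_exponent v b \<nu> u =
    \<i> * of_real (b * u) - of_real (v * u\<^sup>2 / 2) + (CLINT x|\<nu>. levy_integrand u x)"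
  by (simp add: levy_exponent_def levy_integrand_def)

lemma norm_levy_exponent_le:
  assumes nu: "levy_measure \<nu>"
  obtains C where "0 \<le> C" "\<And>u. cmod (levy_exponent v b \<nu> u) \<le> C * (1 + u\<^sup>2)"
proof
  let ?I = "LINT x|\<nu>. min 1 (x\<^sup>2)"
  let ?C = "\<bar>b\<bar> + \<bar>v\<bar> + 2 * ?I"
  have I: "0 \<le> ?I" by simp
  then show "0 \<le> ?C" by simp
  fix u
  have "cmod (CLINT x|\<nu>. levy_integrand u x) \<le> (LINT x|\<nu>. (2 + u\<^sup>2) * min 1 (x\<^sup>2))"
    using norm_levy_integrand_le integrable_levy_measure_min[OF nu] integrable_levy_integrand[OF nu]
    by (intro order_trans[OF integral_norm_bound] integral_mono) auto
  also have "\<dots> = (2 + u\<^sup>2) * ?I" by simp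
  finally have 1: "cmod (CLINT x|\<nu>. levy_integrand u x) \<le> (2 + u\<^sup>2) * ?I" .
  have 2: "cmod (\<i> * of_real (b * u)) \<le> \<bar>b\<bar> * (1 + u\<^sup>2)"
  proof -
    have "0 \<le> (1 - \<bar>u\<bar>)\<^sup>2" by simp
    then have "2 * \<bar>u\<bar> \<le> 1 + u\<^sup>2" by (simp add: power2_diff)
    then have "\<bar>u\<bar> \<le> 1 + u\<^sup>2" by linarith
    then show ?thesis by (simp add: norm_mult abs_mult mult_left_mono del: sum_power2_eq_zero_iff)
  qed
  have 3: "cmod (of_real (v * u\<^sup>2 / 2)) \<le> \<bar>v\<bar> * (1 + u\<^sup>2)"
  proof -
    have "cmod (of_real (v * u\<^sup>2 / 2)) = \<bar>v\<bar> * (u\<^sup>2 / 2)"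
      by (simp add: norm_mult norm_divide norm_power)
    also have "\<dots> \<le> \<bar>v\<bar> * (1 + u\<^sup>2)"
      by (intro mult_left_mono) (auto intro: order_trans[of _ "u\<^sup>2"])
    finally show ?thesis .
  qed
  have "cmod (levy_exponent v b \<nu> u) \<le> \<bar>b\<bar> * (1 + u\<^sup>2) + \<bar>v\<bar> * (1 + u\<^sup>2) + (2 + u\<^sup>2) * ?I"
    unfolding levy_exponent_eq
    by (rule order_trans[OF norm_triangle_ineq] add_mono order_trans[OF norm_triangle_ineq4] 1 2 3)+
  also have "\<dots> \<le> ?C * (1 + u\<^sup>2)"
    using I by (simp add: algebra_simps)
  finally show "cmod (levy_exponent v b \<nu> u) \<le> ?C * (1 + u\<^sup>2)" .
qed

text \<open>Mean value inequality on the left half plane, where the derivative of \<open>exp\<close>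
  has modulus at most 1. It bounds \<open>(exp (t * z) - 1) / t\<close> uniformly in
  \<open>t > 0\<close>.\<close>

lemma norm_exp_minus_one_le:
  fixes z :: complex
  assumes "Re z \<le> 0"
  shows "cmod (exp z - 1) \<le> cmod z"
proof -
  have "cmod (exp z - exp 0) \<le> 1 * cmod (z - 0)"
  proof (rule field_differentiable_bound[where S = "{z. Re z \<le> 0}" and f = exp and f' = exp])
    show "convex {z. Re z \<le> 0}"
      by (rule convex_halfspace_Re_le)
  qed (use assms in \<open>auto intro!: derivative_eq_intros\<close>)
  then show ?thesis by simp
qed

text \<open>Expanded, this is \<open>1 - 2 * exp (- x^2 / 2) + exp (- x^2)\<close>: a combination of
  the characteristic functions of centred Gaussians with standard deviations 0, 1 and
  \<open>sqrt 2\<close>. Multiplying by it therefore amounts to averaging over shifted frequencies.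
  It behaves like \<open>x^4 / 4\<close> at 0 and has no other zero.\<close>

definition levy_weight :: "real \<Rightarrow> real" where
  "levy_weight x = (1 - exp (- x\<^sup>2 / 2))\<^sup>2"

lemma levy_weight_measurable [measurable]: "levy_weight \<in> borel_measurable borel"
  unfolding levy_weight_def by measurable

lemma levy_weight_nonneg: "0 \<le> levy_weight x"
  by (simp add: levy_weight_def)

lemma levy_weight_pos: "x \<noteq> 0 \<Longrightarrow> 0 < levy_weight x"
  by (simp add: levy_weight_def)

lemma levy_weight_le: "levy_weight x \<le> min 1 (x\<^sup>2)"
proof -
  let ?y = "1 - exp (- x\<^sup>2 / 2)"
  have 1: "0 \<le> ?y" "?y \<le> 1" by auto
  have "1 + (- x\<^sup>2 / 2) \<le> exp (- x\<^sup>2 / 2)" by (rule exp_ge_add_one_self)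
  then have 2: "?y \<le> x\<^sup>2" using zero_le_power2[of x] by linarith
  have "?y\<^sup>2 \<le> ?y" using 1 by (simp add: power2_eq_square mult_left_le)
  with 1 2 have "?y\<^sup>2 \<le> 1" "?y\<^sup>2 \<le> x\<^sup>2" by linarith+
  then show ?thesis unfolding levy_weight_def by (rule min.boundedI)
qed

text \<open>The combination of Gaussian frequencies is chosen so that the drift and Gaussian parts of
  a characteristic exponent contribute only terms linear in \<open>z\<close>, which integrate to 0.\<close>

lemma iexp_levy_weight:
  "(CLINT z|std_normal_distribution. iexp (u * x) - 2 * iexp ((u + z) * x) + iexp ((u + sqrt 2 * z) * x))
    = iexp (u * x) * of_real (levy_weight x)"
proof -
  interpret N: real_distribution std_normal_distribution by (rule real_dist_normal_dist)
  have int: "integrable std_normal_distribution (\<lambda>z. iexp (z * y))" for y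
    by (intro N.integrable_const_bound[where B=1]) auto
  have char: "(CLINT z|std_normal_distribution. iexp (z * y)) = of_real (exp (- y\<^sup>2 / 2))" for y
    using fun_cong[OF char_std_normal_distribution, of y] by (simp add: char_def mult.commute)
  have "(CLINT z|std_normal_distribution. iexp (u * x) - 2 * iexp ((u + z) * x) + iexp ((u + sqrt 2 * z) * x))
     = (CLINT z|std_normal_distribution. iexp (u * x) * (1 - 2 * iexp (z * x) + iexp (z * (sqrt 2 * x))))"
    by (intro Bochner_Integration.integral_cong refl)
       (simp add: algebra_simps exp_add[symmetric])
  also have "\<dots> = iexp (u * x) * (1 - 2 * of_real (exp (- x\<^sup>2 / 2)) + of_real (exp (- (sqrt 2 * x)\<^sup>2 / 2)))"
    using int[of x] int[of "sqrt 2 * x"] N.prob_space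
    by (simp only: integral_mult_right_zero Bochner_Integration.integral_add Bochner_Integration.integral_diff
      Bochner_Integration.integrable_diff Bochner_Integration.integrable_add integrable_mult_right
      N.integrable_const integral_mult_right_zero char) simp
  also have "exp (- (sqrt 2 * x)\<^sup>2 / 2) = (exp (- x\<^sup>2 / 2))\<^sup>2"
    by (simp add: power_mult_distrib exp_double[symmetric])
  finally show ?thesis
    by (simp add: levy_weight_def power2_eq_square algebra_simps)
qed

section \<open>Small-time limit of the weighted laws\<close>

lemma integrable_levy_weight:
  assumes "levy_measure \<nu>"
  shows "integrable \<nu> levy_weight"
  using levy_weight_le
  by (intro integrable_levy_measureI[OF assms, where C=1]) (auto simp: levy_weight_nonneg)

text \<open>Fubini moves the Gaussian average from the exponentials to the characteristic function;
  the combination is bounded by 4.\<close>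

lemma integral_iexp_levy_weight_distr:
  assumes "real_distribution P"
  shows "(CLINT x|P. iexp (u * x) * of_real (levy_weight x)) =
    (CLINT z|std_normal_distribution. char P u - 2 * char P (u + z) + char P (u + sqrt 2 * z))"
proof -
  interpret P: real_distribution P by fact
  interpret N: real_distribution std_normal_distribution by (rule real_dist_normal_dist)
  interpret PN: pair_prob_space std_normal_distribution P ..
  let ?D = "\<lambda>z x. iexp (u * x) - 2 * iexp ((u + z) * x) + iexp ((u + sqrt 2 * z) * x)"
  have int: "complex_integrable P (\<lambda>x. iexp (y * x))" for y
    by (intro P.integrable_const_bound[where B=1]) auto
  have "(CLINT x|P. iexp (u * x) * of_real (levy_weight x)) =
      (CLINT x|P. CLINT z|std_normal_distribution. ?D z x)"
    by (simp only: iexp_levy_weight)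
  also have "\<dots> = (CLINT z|std_normal_distribution. CLINT x|P. ?D z x)"
  proof (rule PN.Fubini_integral)
    show "integrable (std_normal_distribution \<Otimes>\<^sub>M P) (\<lambda>(z, x). ?D z x)"
    proof (rule PN.P.integrable_const_bound[where B=4])
      have "cmod (?D z x) \<le> 1 + 2 * 1 + 1" for z x
        by (rule order_trans[OF norm_triangle_ineq] order_trans[OF norm_triangle_ineq4] add_mono)+
           (simp_all add: norm_mult)
      then show "AE p in std_normal_distribution \<Otimes>\<^sub>M P. cmod (case p of (z, x) \<Rightarrow> ?D z x) \<le> 4"
        by (auto simp: split_beta)
    qed measurable
  qed
  also have "\<dots> = (CLINT z|std_normal_distribution. char P u - 2 * char P (u + z) + char P (u + sqrt 2 * z))"
    by (simp only: char_def Bochner_Integration.integral_add Bochner_Integration.integral_diff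
      Bochner_Integration.integrable_diff integrable_mult_right integral_mult_right_zero int)
  finally show ?thesis .
qed

text \<open>The coefficients 1, -2, 1 sum to 0, and the stretch \<open>sqrt 2\<close> is chosen so
  that the \<open>z^2\<close> terms cancel as well: \<open>-2 + (sqrt 2)^2 = 0\<close>. Drift and
  Gaussian part leave only a multiple of \<open>z\<close>, which has mean 0, so only the jump part
  remains.\<close>

lemma integral_levy_exponent_combination:
  assumes nu: "levy_measure \<nu>"
  shows "(CLINT z|std_normal_distribution.
      levy_exponent v b \<nu> u - 2 * levy_exponent v b \<nu> (u + z) + levy_exponent v b \<nu> (u + sqrt 2 * z)) =
    (CLINT x|\<nu>. iexp (u * x) * of_real (levy_weight x))"
proof -
  interpret N: real_distribution std_normal_distribution by (rule real_dist_normal_dist)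
  interpret nu: sigma_finite_measure \<nu> using nu by (rule sigma_finite_levy_measure)
  interpret NN: pair_sigma_finite std_normal_distribution \<nu> ..
  note s [measurable_cong] = sets_levy_measure[OF nu]
  let ?\<kappa> = "\<i> * of_real (b * (sqrt 2 - 2)) + of_real (v * (2 - sqrt 2) * u)"
  let ?D = "\<lambda>z x. levy_integrand u x - 2 * levy_integrand (u + z) x + levy_integrand (u + sqrt 2 * z) x"
  let ?C = "\<lambda>z. (2 + u\<^sup>2) + 2 * (2 + (u + z)\<^sup>2) + (2 + (u + sqrt 2 * z)\<^sup>2)"
  let ?I = "LINT x|\<nu>. min 1 (x\<^sup>2)"
  have id: "integrable std_normal_distribution (\<lambda>z. z)" and id0: "(LINT z|std_normal_distribution. z) = 0"
    using integrable_std_normal_distribution_moment[of 1] integral_std_normal_distribution_moment_odd[of 1]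
    by simp_all
  have lin: "complex_integrable std_normal_distribution (\<lambda>z. c * of_real z)"
    "(CLINT z|std_normal_distribution. c * of_real z) = 0" for c
    by (intro integrable_mult_right integrable_of_real id)
       (simp only: integral_mult_right_zero integral_complex_of_real id0 of_real_0 mult_zero_right)
  have sq: "integrable std_normal_distribution (\<lambda>z. z\<^sup>2)"
    by (rule integrable_std_normal_distribution_moment)
  have int: "integrable \<nu> (?D z)" for z
    using integrable_levy_integrand[OF nu] by auto
  have D: "cmod (?D z x) \<le> ?C z * min 1 (x\<^sup>2)" for z x
  proof -
    have "cmod (?D z x) \<le> (2 + u\<^sup>2) * min 1 (x\<^sup>2) + 2 * ((2 + (u + z)\<^sup>2) * min 1 (x\<^sup>2))
        + (2 + (u + sqrt 2 * z)\<^sup>2) * min 1 (x\<^sup>2)"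
      using norm_levy_integrand_le
      by (intro order_trans[OF norm_triangle_ineq] order_trans[OF norm_triangle_ineq4] add_mono)
         (simp_all add: norm_mult)
    then show ?thesis by (simp add: algebra_simps)
  qed
  have C: "integrable std_normal_distribution ?C"
    using id sq by (simp add: power2_sum power_mult_distrib algebra_simps)
  \<comment> \<open>The inner integral of the norm is at most a quadratic polynomial in
    \<open>z\<close>, and Gaussian second moments are finite.\<close>
  have dint: "integrable (std_normal_distribution \<Otimes>\<^sub>M \<nu>) (\<lambda>(z, x). ?D z x)"
  proof (rule NN.Fubini_integrable)
    show "integrable std_normal_distribution (\<lambda>z. LINT x|\<nu>. cmod (case (z, x) of (z, x) \<Rightarrow> ?D z x))"
    proof (rule Bochner_Integration.integrable_bound)
      show "integrable std_normal_distribution (\<lambda>z. ?C z * ?I)"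
        using C by simp
      show "AE z in std_normal_distribution.
          norm (LINT x|\<nu>. cmod (case (z, x) of (z, x) \<Rightarrow> ?D z x)) \<le> norm (?C z * ?I)"
      proof (intro AE_I2)
        fix z
        have "(LINT x|\<nu>. cmod (?D z x)) \<le> (LINT x|\<nu>. ?C z * min 1 (x\<^sup>2))"
          using D int integrable_levy_measure_min[OF nu] by (intro integral_mono) auto
        also have "\<dots> = ?C z * ?I" by simp
        finally have "(LINT x|\<nu>. cmod (?D z x)) \<le> \<bar>?C z * ?I\<bar>" by linarith
        then show "norm (LINT x|\<nu>. cmod (case (z, x) of (z, x) \<Rightarrow> ?D z x)) \<le> norm (?C z * ?I)"
          by simp
      qed
    qed measurable
  qed (use int in auto)
  have "levy_exponent v b \<nu> u - 2 * levy_exponent v b \<nu> (u + z) + levy_exponent v b \<nu> (u + sqrt 2 * z) =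
      ?\<kappa> * of_real z + (CLINT x|\<nu>. ?D z x)" for z
  proof -
    have "(CLINT x|\<nu>. ?D z x) = (CLINT x|\<nu>. levy_integrand u x) - 2 * (CLINT x|\<nu>. levy_integrand (u + z) x)
       + (CLINT x|\<nu>. levy_integrand (u + sqrt 2 * z) x)"
      using integrable_levy_integrand[OF nu] by simp
    moreover have "\<i> * of_real (b * u) - of_real (v * u\<^sup>2 / 2) + A0
        - 2 * (\<i> * of_real (b * (u + z)) - of_real (v * (u + z)\<^sup>2 / 2) + A1)
        + (\<i> * of_real (b * (u + sqrt 2 * z)) - of_real (v * (u + sqrt 2 * z)\<^sup>2 / 2) + A2) =
        ?\<kappa> * of_real z + (A0 - 2 * A1 + A2)" for A0 A1 A2
    proof -
      have "v * u\<^sup>2 / 2 - 2 * (v * (u + z)\<^sup>2 / 2) + v * (u + sqrt 2 * z)\<^sup>2 / 2 = - (v * (2 - sqrt 2) * u * z)"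
        by (simp add: power2_sum power_mult_distrib field_simps)
      then have "complex_of_real (v * u\<^sup>2 / 2) - 2 * of_real (v * (u + z)\<^sup>2 / 2)
          + of_real (v * (u + sqrt 2 * z)\<^sup>2 / 2) = - of_real (v * (2 - sqrt 2) * u * z)"
        by (metis of_real_add of_real_diff of_real_minus of_real_mult of_real_numeral)
      moreover have "\<i> * of_real (b * u) - 2 * (\<i> * of_real (b * (u + z))) + \<i> * of_real (b * (u + sqrt 2 * z))
          = \<i> * of_real (b * (sqrt 2 - 2)) * of_real z"
        by (simp add: algebra_simps)
      moreover have "x0 - y0 + A0 - 2 * (x1 - y1 + A1) + (x2 - y2 + A2) =
          (x0 - 2 * x1 + x2) - (y0 - 2 * y1 + y2) + (A0 - 2 * A1 + A2)" for x0 y0 x1 y1 x2 y2 :: complex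
        by simp
      ultimately show ?thesis by (simp only:) (simp add: distrib_right)
    qed
    ultimately show ?thesis
      unfolding levy_exponent_eq by simp
  qed
  then have "(CLINT z|std_normal_distribution.
      levy_exponent v b \<nu> u - 2 * levy_exponent v b \<nu> (u + z) + levy_exponent v b \<nu> (u + sqrt 2 * z)) =
      (CLINT z|std_normal_distribution. ?\<kappa> * of_real z + (CLINT x|\<nu>. ?D z x))"
    by simp
  also have "\<dots> = (CLINT z|std_normal_distribution. CLINT x|\<nu>. ?D z x)"
    by (simp only: Bochner_Integration.integral_add[OF lin(1) NN.integrable_fst[OF dint]] lin(2) add_0_left)
  also have "\<dots> = (CLINT x|\<nu>. CLINT z|std_normal_distribution. ?D z x)"
    using NN.Fubini_integral[OF dint] by simp
  also have "\<dots> = (CLINT x|\<nu>. iexp (u * x) * of_real (levy_weight x))"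
  proof (intro Bochner_Integration.integral_cong refl)
    fix x
    let ?E = "\<lambda>z. iexp (u * x) - 2 * iexp ((u + z) * x) + iexp ((u + sqrt 2 * z) * x)"
    \<comment> \<open>The truncation term of the Levy integrand is linear in the frequency, so it
      too leaves only a multiple of \<open>z\<close>.\<close>
    let ?c = "\<i> * of_real ((2 - sqrt 2) * x * indicator {-1..1} x)"
    have E: "complex_integrable std_normal_distribution ?E"
      by (intro Bochner_Integration.integrable_add Bochner_Integration.integrable_diff
        Bochner_Integration.integrable_mult_right N.integrable_const_bound[where B=1]) auto
    have "?D z x = ?E z + ?c * of_real z" for z
      by (simp add: levy_integrand_def algebra_simps)
    then have "(CLINT z|std_normal_distribution. ?D z x) = (CLINT z|std_normal_distribution. ?E z + ?c * of_real z)"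
      by simp
    also have "\<dots> = (CLINT z|std_normal_distribution. ?E z)"
      by (simp only: Bochner_Integration.integral_add[OF E lin(1)] lin(2) add_0_right)
    also have "\<dots> = iexp (u * x) * of_real (levy_weight x)"
      by (rule iexp_levy_weight)
    finally show "(CLINT z|std_normal_distribution. ?D z x) = iexp (u * x) * of_real (levy_weight x)" .
  qed
  finally show ?thesis .
qed

lemma tendsto_exp_minus_one_divide:
  fixes z :: complex and t :: "nat \<Rightarrow> real"
  assumes "t \<longlonglongrightarrow> 0" "\<And>n. 0 < t n"
  shows "(\<lambda>n. (exp (of_real (t n) * z) - 1) / of_real (t n)) \<longlonglongrightarrow> z"
proof -
  have "((\<lambda>s::complex. exp (s * z)) has_field_derivative z) (at 0)"
    by (auto intro!: derivative_eq_intros)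
  then have "((\<lambda>s. (exp (s * z) - 1) / s) \<longlongrightarrow> z) (at 0)"
    by (simp add: has_field_derivative_iff)
  moreover have "filterlim (\<lambda>n. complex_of_real (t n)) (at 0) sequentially"
  proof -
    have "t n \<noteq> 0" for n
      using assms(2)[of n] by simp
    moreover have "(\<lambda>n. complex_of_real (t n)) \<longlonglongrightarrow> of_real 0"
      using assms(1) by (rule tendsto_of_real)
    ultimately show ?thesis
      by (simp add: filterlim_at)
  qed
  ultimately show ?thesis
    by (rule filterlim_compose)
qed

context
  fixes P :: "nat \<Rightarrow> real measure" and t :: "nat \<Rightarrow> real" and \<nu> :: "real measure" and v b :: real
  assumes nu: "levy_measure \<nu>" and dist: "\<And>n. real_distribution (P n)"
    and t_pos: "\<And>n. 0 < t n" and t_lim: "t \<longlonglongrightarrow> 0"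
    and char: "\<And>n u. char (P n) u = exp (of_real (t n) * levy_exponent v b \<nu> u)"
begin

lemma small_time_char:
  "(\<lambda>n. (char (P n) u - 1) / t n) \<longlonglongrightarrow> levy_exponent v b \<nu> u"
  unfolding char by (rule tendsto_exp_minus_one_divide[OF t_lim t_pos])

text \<open>A characteristic function has modulus at most 1, which forces the exponent into the left
  half plane, where \<open>norm_exp_minus_one_le\<close> applies. The bound does not depend on
  \<open>n\<close>, as dominated convergence requires.\<close>

lemma norm_small_time_char_le: "cmod ((char (P n) u - 1) / t n) \<le> cmod (levy_exponent v b \<nu> u)"
proof -
  have "exp (t n * Re (levy_exponent v b \<nu> u)) \<le> 1"
    using real_distribution.cmod_char_le_1[OF dist, of n u] by (simp add: char)
  then have "Re (of_real (t n) * levy_exponent v b \<nu> u) \<le> 0"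
    by simp
  from norm_exp_minus_one_le[OF this] show ?thesis
    using t_pos[of n] by (simp add: char norm_divide norm_mult field_simps)
qed

text \<open>Both sides are Gaussian averages over frequencies, so pointwise convergence of the
  difference quotients passes to the limit by dominated convergence, with quadratic growth in
  \<open>z\<close> as the dominating bound.\<close>

lemma small_time_weighted_char:
  "(\<lambda>n. (CLINT x|P n. iexp (u * x) * of_real (levy_weight x)) / t n)
     \<longlonglongrightarrow> (CLINT x|\<nu>. iexp (u * x) * of_real (levy_weight x))"
proof -
  interpret N: real_distribution std_normal_distribution by (rule real_dist_normal_dist)
  obtain C where C: "0 \<le> C" "\<And>u. cmod (levy_exponent v b \<nu> u) \<le> C * (1 + u\<^sup>2)"
    using norm_levy_exponent_le[OF nu] by metis
  let ?q = "\<lambda>n u. (char (P n) u - 1) / t n"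
  have q: "cmod (?q n u) \<le> C * (1 + u\<^sup>2)" for n u
    using norm_small_time_char_le C(2) by (rule order_trans)
  let ?B = "\<lambda>z. C * (1 + u\<^sup>2) + 2 * (C * (1 + (u + z)\<^sup>2)) + C * (1 + (u + sqrt 2 * z)\<^sup>2)"
  have "(p - 1) / s - 2 * ((q - 1) / s) + (r - 1) / s = (p - 2 * q + r) / s" for p q r s :: complex
    by (cases "s = 0") (simp_all add: field_simps)
  then have pt: "?q n u - 2 * ?q n (u + z) + ?q n (u + sqrt 2 * z) =
      (char (P n) u - 2 * char (P n) (u + z) + char (P n) (u + sqrt 2 * z)) / t n" for n z
    by (simp only:)
  have [measurable]: "char (P n) \<in> borel_measurable borel" for n
    using real_distribution.char_measurable[OF dist] .
  \<comment> \<open>The exponent is a pointwise limit of measurable difference quotients.\<close>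
  have [measurable]: "levy_exponent v b \<nu> \<in> borel_measurable borel"
    by (rule borel_measurable_LIMSEQ_metric[OF _ small_time_char]) measurable
  have "(\<lambda>n. CLINT z|std_normal_distribution. ?q n u - 2 * ?q n (u + z) + ?q n (u + sqrt 2 * z))
     \<longlonglongrightarrow> (CLINT z|std_normal_distribution.
      levy_exponent v b \<nu> u - 2 * levy_exponent v b \<nu> (u + z) + levy_exponent v b \<nu> (u + sqrt 2 * z))"
  proof (rule integral_dominated_convergence[where w="?B"])
    have "integrable std_normal_distribution (\<lambda>z. z)" "integrable std_normal_distribution (\<lambda>z. z\<^sup>2)"
      using integrable_std_normal_distribution_moment[of 1] integrable_std_normal_distribution_moment[of 2] by simp_all
    then show "integrable std_normal_distribution ?B"
      by (simp add: power2_sum power_mult_distrib algebra_simps)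
    show "AE z in std_normal_distribution.
      (\<lambda>n. ?q n u - 2 * ?q n (u + z) + ?q n (u + sqrt 2 * z)) \<longlonglongrightarrow>
      levy_exponent v b \<nu> u - 2 * levy_exponent v b \<nu> (u + z) + levy_exponent v b \<nu> (u + sqrt 2 * z)"
      by (intro AE_I2 tendsto_intros small_time_char)
    show "AE z in std_normal_distribution.
      cmod (?q n u - 2 * ?q n (u + z) + ?q n (u + sqrt 2 * z)) \<le> ?B z" for n
    proof (intro AE_I2)
      fix z
      have "cmod (2 * ?q n (u + z)) \<le> 2 * (C * (1 + (u + z)\<^sup>2))"
        unfolding norm_mult using q[of n "u + z"] by simp
      then show "cmod (?q n u - 2 * ?q n (u + z) + ?q n (u + sqrt 2 * z)) \<le> ?B z"
        by (intro order_trans[OF norm_triangle_ineq] order_trans[OF norm_triangle_ineq4] add_mono q)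
    qed
  qed measurable
  also have "(\<lambda>n. CLINT z|std_normal_distribution. ?q n u - 2 * ?q n (u + z) + ?q n (u + sqrt 2 * z)) =
     (\<lambda>n. (CLINT x|P n. iexp (u * x) * of_real (levy_weight x)) / t n)"
    by (simp only: pt integral_divide_zero integral_iexp_levy_weight_distr[OF dist])
  finally show ?thesis
    unfolding integral_levy_exponent_combination[OF nu] .
qed

text \<open>Levy's continuity theorem concerns probability measures, so the weighted measures are
  normalised first. Their masses divided by \<open>t n\<close> converge (frequency 0) to a positive
  limit, which allows the normalisation to be undone at the end.\<close>

lemma small_time_weak_limit:
  fixes r :: "real \<Rightarrow> real"
  assumes cont: "\<And>x. isCont r x" and bdd: "\<And>x. \<bar>r x\<bar> \<le> B"
    and nonzero: "0 < (LINT x|\<nu>. levy_weight x)"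
  shows "(\<lambda>n. (LINT x|P n. levy_weight x * r x) / t n) \<longlonglongrightarrow> (LINT x|\<nu>. levy_weight x * r x)"
proof -
  note s [measurable_cong] = sets_levy_measure[OF nu]
  let ?m = "\<lambda>n. LINT x|P n. levy_weight x" and ?c = "LINT x|\<nu>. levy_weight x"
  have r [measurable]: "r \<in> borel_measurable borel"
    using cont by (intro borel_measurable_continuous_onI continuous_at_imp_continuous_on) auto
  have sP [measurable_cong]: "sets (P n) = sets borel" for n
    using real_distribution.events_eq_borel[OF dist] .
  have mass: "(\<lambda>n. ?m n / t n) \<longlonglongrightarrow> ?c"
    using tendsto_Re[OF small_time_weighted_char[of 0]] by simp
  have "eventually (\<lambda>n. 0 < ?m n / t n) sequentially"
    using order_tendstoD(1)[OF mass nonzero] .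
  \<comment> \<open>Positivity of the masses follows from the limit only from some index on, so the
    normalised sequence is shifted by \<open>n0\<close>; \<open>LIMSEQ_offset\<close> removes the
    shift at the end.\<close>
  then obtain n0 where n0: "\<And>n. n \<ge> n0 \<Longrightarrow> 0 < ?m n"
    using t_pos by (auto simp: eventually_sequentially zero_less_divide_iff) (metis less_asym)
  define Q where "Q n = density (P (n + n0)) (\<lambda>x. levy_weight x / ?m (n + n0))" for n
  define Q' where "Q' = density \<nu> (\<lambda>x. levy_weight x / ?c)"
  have rd: "real_distribution (density R (\<lambda>x. levy_weight x / (LINT x|R. levy_weight x)))"
    if "sets R = sets borel" "integrable R levy_weight" "0 < (LINT x|R. levy_weight x)" for R
  proof -
    note [measurable_cong] = that(1)
    have "prob_space (density R (\<lambda>x. levy_weight x / (LINT x|R. levy_weight x)))"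
    proof (rule prob_spaceI)
      have "emeasure (density R (\<lambda>x. levy_weight x / (LINT x|R. levy_weight x))) (space R) =
          (\<integral>\<^sup>+x. ennreal (levy_weight x / (LINT x|R. levy_weight x)) \<partial>R)"
        by (subst emeasure_density) (auto intro!: nn_integral_cong)
      also have "\<dots> = ennreal (LINT x|R. levy_weight x / (LINT x|R. levy_weight x))"
        using that by (intro nn_integral_eq_integral) (auto simp: levy_weight_nonneg)
      also have "\<dots> = 1" using that(3) by simp
      finally show "emeasure (density R (\<lambda>x. levy_weight x / (LINT x|R. levy_weight x)))
          (space (density R (\<lambda>x. levy_weight x / (LINT x|R. levy_weight x)))) = 1"
        by simp
    qed
    then show ?thesis
      using that(1) sets_eq_imp_space_eq[OF that(1)]
      by (simp add: real_distribution_def real_distribution_axioms_def)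
  qed
  have intP: "integrable (P n) levy_weight" for n
  proof -
    interpret real_distribution "P n" by (rule dist)
    show ?thesis
      using levy_weight_le by (intro integrable_const_bound[where B=1]) (auto simp: levy_weight_nonneg)
  qed
  have Qdist: "real_distribution (Q n)" for n
    unfolding Q_def using sP intP n0 by (intro rd) auto
  have Q'dist: "real_distribution Q'"
    unfolding Q'_def using s integrable_levy_weight[OF nu] nonzero by (intro rd) auto
  have Qint: "(LINT x|Q n. f x) = inverse (?m (n + n0)) *\<^sub>R (LINT x|P (n + n0). levy_weight x *\<^sub>R f x)"
    if [measurable]: "f \<in> borel_measurable borel" for f :: "real \<Rightarrow> 'z::{banach, second_countable_topology}" and n
    unfolding Q_def using n0[of "n + n0"]
    by (subst integral_density)
       (auto simp: levy_weight_nonneg divide_inverse mult.commute integral_scaleR_right[symmetric]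
          simp del: integral_scaleR_right)
  have Q'int: "(LINT x|Q'. f x) = inverse ?c *\<^sub>R (LINT x|\<nu>. levy_weight x *\<^sub>R f x)"
    if [measurable]: "f \<in> borel_measurable borel" for f :: "real \<Rightarrow> 'z::{banach, second_countable_topology}"
    unfolding Q'_def using nonzero
    by (subst integral_density)
       (auto simp: levy_weight_nonneg divide_inverse mult.commute integral_scaleR_right[symmetric]
          simp del: integral_scaleR_right)
  have t_nz: "t n \<noteq> 0" for n
    using t_pos[of n] by simp
  have "weak_conv_m Q Q'"
  proof (rule levy_continuity[OF Qdist Q'dist])
    fix u
    have eq: "(CLINT x|R. levy_weight x *\<^sub>R iexp (u * x)) = (CLINT x|R. iexp (u * x) * of_real (levy_weight x))" for R
      by (simp add: scaleR_conv_of_real mult.commute)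
    \<comment> \<open>The normalised transform is a quotient of two quantities of order
      \<open>t\<close>; dividing both by \<open>t\<close> makes each converge.\<close>
    have "(\<lambda>n. inverse (?m (n + n0) / t (n + n0)) *\<^sub>R
        ((CLINT x|P (n + n0). iexp (u * x) * of_real (levy_weight x)) / t (n + n0)))
      \<longlonglongrightarrow> inverse ?c *\<^sub>R (CLINT x|\<nu>. iexp (u * x) * of_real (levy_weight x))"
      using nonzero
      by (intro tendsto_intros LIMSEQ_ignore_initial_segment[OF mass]
        LIMSEQ_ignore_initial_segment[OF small_time_weighted_char]) auto
    also have "(\<lambda>n. inverse (?m (n + n0) / t (n + n0)) *\<^sub>R
        ((CLINT x|P (n + n0). iexp (u * x) * of_real (levy_weight x)) / t (n + n0))) = (\<lambda>n. char (Q n) u)"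
      unfolding char_def
      by (subst Qint) (auto simp: eq scaleR_conv_of_real t_nz field_simps)
    also have "inverse ?c *\<^sub>R (CLINT x|\<nu>. iexp (u * x) * of_real (levy_weight x)) = char Q' u"
      unfolding char_def by (subst Q'int) (auto simp: eq[simplified])
    finally show "(\<lambda>n. char (Q n) u) \<longlonglongrightarrow> char Q' u" .
  qed
  then have "(\<lambda>n. LINT x|Q n. r x) \<longlonglongrightarrow> (LINT x|Q'. r x)"
    using Qdist Q'dist cont bdd by (intro weak_conv_imp_integral_bdd_continuous_conv[where B=B]) auto
  then have "(\<lambda>n. ?m (n + n0) / t (n + n0) * (LINT x|Q n. r x)) \<longlonglongrightarrow> ?c * (LINT x|Q'. r x)"
    by (intro tendsto_intros LIMSEQ_ignore_initial_segment[OF mass])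
  also have "(\<lambda>n. ?m (n + n0) / t (n + n0) * (LINT x|Q n. r x)) =
      (\<lambda>n. (LINT x|P (n + n0). levy_weight x * r x) / t (n + n0))"
  proof
    fix n show "?m (n + n0) / t (n + n0) * (LINT x|Q n. r x) =
      (LINT x|P (n + n0). levy_weight x * r x) / t (n + n0)"
      using n0[of "n + n0"] by (subst Qint) (auto simp: field_simps)
  qed
  also have "?c * (LINT x|Q'. r x) = (LINT x|\<nu>. levy_weight x * r x)"
    using nonzero by (subst Q'int) (auto simp: field_simps)
  finally show ?thesis
    by (rule LIMSEQ_offset)
qed

end

section \<open>Test functions and the capped exponential\<close>

lemma levy_weight_ge:
  assumes "1 \<le> \<bar>x\<bar>"
  shows "levy_weight 1 \<le> levy_weight x"
proof -
  have "1 \<le> x\<^sup>2" using assms by (metis one_le_power power2_abs)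
  then have "exp (- x\<^sup>2 / 2) \<le> exp (- 1\<^sup>2 / 2)" by simp
  moreover have "exp (- 1\<^sup>2 / 2 :: real) \<le> 1" by simp
  ultimately show ?thesis
    unfolding levy_weight_def by (intro power_mono) linarith+
qed

lemma isCont_levy_weight [continuous_intros]: "isCont levy_weight x"
  unfolding levy_weight_def by (intro continuous_intros) auto

lemma exp_second_order_bound:
  fixes x :: real
  assumes "\<bar>x\<bar> \<le> 1"
  shows "\<bar>exp x - 1 - x\<bar> \<le> x\<^sup>2"
proof -
  have "exp x \<le> 1 + x + x\<^sup>2"
  proof (cases "0 \<le> x")
    case True
    then show ?thesis using assms exp_bound[of x] by auto
  next
    case False
    \<comment> \<open>For negative \<open>x\<close> the bound rests on
      \<open>exp x <= 1 / (1 - x)\<close> together with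
      \<open>(1 + x + x^2) * (1 - x) = 1 - x^3 >= 1\<close>.\<close>
    have "exp x * (1 - x) \<le> exp x * exp (- x)"
      using exp_ge_add_one_self[of "- x"] by (intro mult_left_mono) auto
    also have "\<dots> = 1" by (simp add: exp_minus)
    also have "\<dots> \<le> (1 + x + x\<^sup>2) * (1 - x)"
    proof -
      have "x ^ 3 \<le> 0" using False by (simp add: power_le_zero_eq)
      then show ?thesis by (simp add: algebra_simps power2_eq_square power3_eq_cube)
    qed
    finally show ?thesis using False by (simp add: mult_le_cancel_right)
  qed
  then show ?thesis using exp_ge_add_one_self[of x] by linarith
qed

text \<open>A common integrable bound for the compensated exponential and for every call payoff: the
  first summand serves near 0, and the second absorbs the exponential growth controlled by the
  moment assumption.\<close>

definition levy_exp_dominant :: "real \<Rightarrow> real" where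
  "levy_exp_dominant x = min 1 (x\<^sup>2) + exp x * indicator {x. 1 < \<bar>x\<bar>} x"

lemma levy_exp_dominant_nonneg: "0 \<le> levy_exp_dominant x"
  by (simp add: levy_exp_dominant_def)

lemma integrable_levy_exp_dominant:
  assumes nu: "levy_measure \<nu>"
    and moment: "(\<integral>\<^sup>+x\<in>{x. 1 < \<bar>x\<bar>}. ennreal (exp x) \<partial>\<nu>) < \<infinity>"
  shows "integrable \<nu> levy_exp_dominant"
  unfolding levy_exp_dominant_def
proof (rule Bochner_Integration.integrable_add[OF integrable_levy_measure_min[OF nu]])
  note [measurable_cong] = sets_levy_measure[OF nu]
  have "(\<lambda>x. exp x * indicator {x. 1 < \<bar>x\<bar>} x :: real) \<in> borel_measurable \<nu>"
    by measurable
  moreover have "(\<integral>\<^sup>+x. norm (exp x * indicator {x. 1 < \<bar>x\<bar>} x :: real) \<partial>\<nu>) =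
      (\<integral>\<^sup>+x\<in>{x. 1 < \<bar>x\<bar>}. ennreal (exp x) \<partial>\<nu>)"
    by (intro nn_integral_cong) (auto simp: indicator_def)
  ultimately show "integrable \<nu> (\<lambda>x. exp x * indicator {x. 1 < \<bar>x\<bar>} x :: real)"
    using moment by (simp add: integrable_iff_bounded)
qed

lemma norm_exp_levy_integrand_le:
  "\<bar>exp x - 1 - x * indicator {-1..1} x\<bar> \<le> levy_exp_dominant x"
proof (cases "\<bar>x\<bar> \<le> 1")
  case True
  then have "min 1 (x\<^sup>2) = x\<^sup>2" by (simp add: abs_square_le_1)
  then show ?thesis
    using exp_second_order_bound[OF True] True
    by (auto simp: levy_exp_dominant_def indicator_def abs_le_iff)
next
  case False
  then have "1 < x\<^sup>2"
    by (metis abs_ge_zero not_le one_less_power pos2 power2_abs)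
  then have "min 1 (x\<^sup>2) = 1" by simp
  moreover have "\<bar>exp x - 1\<bar> \<le> 1 + exp x"
    using exp_gt_zero[of x] by linarith
  ultimately show ?thesis
    using False by (auto simp: levy_exp_dominant_def indicator_def abs_le_iff)
qed

text \<open>On \<open>\<bar>x\<bar> \<le> 1\<close> the payoff is nonzero only for
  \<open>x > K\<close>, where \<open>x^2 / K^2 > 1\<close>; the 3 is a bound for
  \<open>exp 1\<close>.\<close>

lemma call_payoff_le_dominant:
  fixes K :: real
  assumes "0 < K"
  shows "max (exp x - exp K) 0 \<le> (1 + 3 / K\<^sup>2) * levy_exp_dominant x"
proof (cases "\<bar>x\<bar> \<le> 1")
  case True
  show ?thesis
  proof (cases "K < x")
    case True
    have "exp x - exp K \<le> 3"
    proof -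
      have "exp x \<le> exp 1" using \<open>\<bar>x\<bar> \<le> 1\<close> by simp
      then show ?thesis using exp_le exp_gt_zero[of K] by linarith
    qed
    also have "3 \<le> 3 / K\<^sup>2 * x\<^sup>2"
      using True assms power_mono[of K x 2] by (simp add: field_simps)
    also have "\<dots> \<le> (1 + 3 / K\<^sup>2) * x\<^sup>2"
      by (intro mult_right_mono) auto
    also have "x\<^sup>2 \<le> levy_exp_dominant x"
      using \<open>\<bar>x\<bar> \<le> 1\<close> by (simp add: levy_exp_dominant_def min_def abs_square_le_1)
    finally show ?thesis
      by (simp add: levy_exp_dominant_nonneg mult_left_mono)
  next
    case False
    then show ?thesis by (simp add: levy_exp_dominant_nonneg)
  qed
next
  case False
  have "max (exp x - exp K) 0 \<le> 1 * exp x" by simp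
  also have "\<dots> \<le> (1 + 3 / K\<^sup>2) * levy_exp_dominant x"
    using False by (intro mult_mono) (auto simp: levy_exp_dominant_def)
  finally show ?thesis .
qed

context
  fixes \<nu> :: "real measure"
  assumes nu: "levy_measure \<nu>"
    and moment: "(\<integral>\<^sup>+x\<in>{x. 1 < \<bar>x\<bar>}. ennreal (exp x) \<partial>\<nu>) < \<infinity>"
begin

lemma integrable_exp_levy_integrand: "integrable \<nu> (\<lambda>x. exp x - 1 - x * indicator {-1..1} x)"
proof (rule Bochner_Integration.integrable_bound[OF integrable_levy_exp_dominant[OF nu moment]])
  note [measurable_cong] = sets_levy_measure[OF nu]
  show "(\<lambda>x. exp x - 1 - x * indicator {-1..1} x) \<in> borel_measurable \<nu>" by measurable
  show "AE x in \<nu>. norm (exp x - 1 - x * indicator {-1..1} x) \<le> norm (levy_exp_dominant x)"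
    using norm_exp_levy_integrand_le by (intro AE_I2) (simp add: levy_exp_dominant_nonneg)
qed

lemma integrable_call_payoff:
  assumes "0 < K"
  shows "integrable \<nu> (\<lambda>x. max (exp x - exp K) 0)"
proof (rule Bochner_Integration.integrable_bound)
  note [measurable_cong] = sets_levy_measure[OF nu]
  show "integrable \<nu> (\<lambda>x. (1 + 3 / K\<^sup>2) * levy_exp_dominant x)"
    using integrable_levy_exp_dominant[OF nu moment] by simp
  show "(\<lambda>x. max (exp x - exp K) 0) \<in> borel_measurable \<nu>" by measurable
  show "AE x in \<nu>. norm (max (exp x - exp K) 0) \<le> norm ((1 + 3 / K\<^sup>2) * levy_exp_dominant x)"
    using call_payoff_le_dominant[OF assms]
    by (intro AE_I2) (simp only: real_norm_def abs_of_nonneg max.cobounded2 mult_nonneg_nonneg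
      levy_exp_dominant_nonneg add_nonneg_nonneg zero_le_one divide_nonneg_nonneg zero_le_numeral zero_le_power2)
qed

end

text \<open>The trigonometric part agrees with \<open>exp x - 1\<close> at 0 up to terms of order \<open>x ^ 4\<close>, the
  order at which \<open>levy_weight\<close> vanishes; the quotient of the difference by the weight tends to \<open>1 / 3\<close>.\<close>

definition trig_approx :: "real \<Rightarrow> real" where
  "trig_approx x = 5 / 3 * sin x - 1 / 3 * sin (2 * x) + (1 - cos x)"

definition capped_exp_quotient :: "real \<Rightarrow> real \<Rightarrow> real" where
  "capped_exp_quotient K x =
    (if x = 0 then 1 / 3 else (min (exp x) (exp K) - 1 - trig_approx x) / levy_weight x)"

lemma capped_exp_decomposition:
  assumes "0 < K"
  shows "min (exp x) (exp K) - 1 = trig_approx x + levy_weight x * capped_exp_quotient K x"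
  using levy_weight_pos[of x] assms by (cases "x = 0") (auto simp: levy_weight_def capped_exp_quotient_def trig_approx_def)

text \<open>Near 0 the sines contribute \<open>x + x^3 / 6\<close>, because
  \<open>5/3 - 2/3 = 1\<close> and \<open>-5/18 + 8/18 = 1/6\<close>, and \<open>1 - cos x\<close>
  contributes \<open>x^2 / 2 - x^4 / 24\<close>. The difference from \<open>exp x - 1\<close> is
  thus about \<open>x^4 / 12\<close>; against a weight of about \<open>x^4 / 4\<close> this gives
  the value 1/3.\<close>

lemma isCont_capped_exp_quotient:
  assumes "0 < K"
  shows "isCont (capped_exp_quotient K) x"
proof (cases "x = 0")
  case True
  have "((\<lambda>x::real. (exp x - 1 - (5 / 3 * sin x - 1 / 3 * sin (2 * x) + (1 - cos x)))
      / (1 - exp (- x\<^sup>2 / 2))\<^sup>2) \<longlongrightarrow> 1 / 3) (at 0)"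
    by real_asymp (simp_all add: power2_eq_square)
  moreover have "\<forall>\<^sub>F x in at 0. capped_exp_quotient K x =
     (exp x - 1 - (5 / 3 * sin x - 1 / 3 * sin (2 * x) + (1 - cos x))) / (1 - exp (- x\<^sup>2 / 2))\<^sup>2"
  proof -
    \<comment> \<open>Since \<open>K\<close> is positive, the cap is inactive near 0.\<close>
    have "\<forall>\<^sub>F x in at 0. x < K"
      using assms by (intro eventually_at_in_open' [of "{..<K}", simplified]) auto
    moreover have "\<forall>\<^sub>F x in at (0::real). x \<noteq> 0"
      by (auto simp: eventually_at_filter)
    ultimately show ?thesis
      by eventually_elim (auto simp: capped_exp_quotient_def trig_approx_def levy_weight_def min_def)
  qed
  ultimately show ?thesis
    using True by (simp add: isCont_def tendsto_cong) (simp add: capped_exp_quotient_def)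
next
  case False
  have "isCont (\<lambda>x. (min (exp x) (exp K) - 1 - trig_approx x) / levy_weight x) x"
    unfolding trig_approx_def using levy_weight_pos[OF False]
    by (intro continuous_intros) auto
  moreover have "\<forall>\<^sub>F y in nhds x. y \<noteq> 0"
    using False by (intro t1_space_nhds)
  then have "\<forall>\<^sub>F y in nhds x. capped_exp_quotient K y = (min (exp y) (exp K) - 1 - trig_approx y) / levy_weight y"
    by eventually_elim (simp add: capped_exp_quotient_def)
  ultimately show ?thesis
    by (subst isCont_cong)
qed

lemma bounded_capped_exp_quotient:
  assumes "0 < K"
  obtains B where "\<And>x. \<bar>capped_exp_quotient K x\<bar> \<le> B"
proof -
  have "compact (capped_exp_quotient K ` {-1..1})"
    using isCont_capped_exp_quotient[OF assms]
    by (intro compact_continuous_image continuous_at_imp_continuous_on) auto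
  then obtain B1 where "\<forall>y\<in>capped_exp_quotient K ` {-1..1}. norm y \<le> B1"
    using compact_imp_bounded bounded_iff by metis
  then have B1: "\<bar>capped_exp_quotient K x\<bar> \<le> B1" if "\<bar>x\<bar> \<le> 1" for x
    using that by (simp add: abs_le_iff)
  have "\<bar>capped_exp_quotient K x\<bar> \<le> (exp K + 5) / levy_weight 1" if "1 < \<bar>x\<bar>" for x
  proof -
    \<comment> \<open>The 5 is the sum of 1 and the bounds 5/3, 1/3 and 2 for the terms of
      \<open>trig_approx\<close>.\<close>
    have "\<bar>min (exp x) (exp K) - 1 - trig_approx x\<bar> \<le> exp K + 5"
    proof -
      have "0 < min (exp x) (exp K)" "min (exp x) (exp K) \<le> exp K" by auto
      then show ?thesis
        using sin_le_one[of x] sin_ge_minus_one[of x] sin_le_one[of "2 * x"] sin_ge_minus_one[of "2 * x"]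
          cos_le_one[of x] cos_ge_minus_one[of x]
        unfolding trig_approx_def abs_le_iff by linarith
    qed
    then show ?thesis
      using that levy_weight_ge[of x] levy_weight_pos[of 1]
      by (auto simp: capped_exp_quotient_def intro!: frac_le)
  qed
  then have "\<bar>capped_exp_quotient K x\<bar> \<le> max B1 ((exp K + 5) / levy_weight 1)" for x
    using B1[of x] by (cases "\<bar>x\<bar> \<le> 1") (auto simp: le_max_iff_disj)
  then show thesis using that by blast
qed

context
  fixes P :: "nat \<Rightarrow> real measure" and t :: "nat \<Rightarrow> real" and \<nu> :: "real measure" and v b :: real
  assumes nu: "levy_measure \<nu>" and dist: "\<And>n. real_distribution (P n)"
    and t_pos: "\<And>n. 0 < t n" and t_lim: "t \<longlonglongrightarrow> 0"
    and char: "\<And>n u. char (P n) u = exp (of_real (t n) * levy_exponent v b \<nu> u)"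
    and nonzero: "0 < (LINT x|\<nu>. levy_weight x)"
begin

text \<open>A function that is 0 on a neighbourhood of 0 can be divided by the weight without losing
  continuity or boundedness. At 0 the quotient is \<open>0 / 0\<close>, which evaluates to 0 and is
  the right value there.\<close>

lemma small_time_limit_vanishing:
  fixes f :: "real \<Rightarrow> real"
  assumes cont: "\<And>x. isCont f x" and bdd: "\<And>x. \<bar>f x\<bar> \<le> B" and zero: "\<And>x. \<bar>x\<bar> \<le> 1 \<Longrightarrow> f x = 0"
  shows "(\<lambda>n. (LINT x|P n. f x) / t n) \<longlonglongrightarrow> (LINT x|\<nu>. f x)"
proof -
  let ?r = "\<lambda>x. f x / levy_weight x"
  have "isCont ?r x" for x
  proof (cases "x = 0")
    case True
    have "\<forall>\<^sub>F y in nhds 0. \<bar>y\<bar> < (1::real)"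
      by (rule eventually_nhds_metric[THEN iffD2]) (auto intro!: exI[of _ 1])
    then have "\<forall>\<^sub>F y in nhds 0. ?r y = 0"
      by eventually_elim (simp add: zero)
    from isCont_cong[OF this] True show ?thesis by simp
  next
    case False
    then show ?thesis
      using levy_weight_pos[of x] by (intro continuous_intros cont) auto
  qed
  moreover have "\<bar>?r x\<bar> \<le> B / levy_weight 1" for x
  proof (cases "\<bar>x\<bar> \<le> 1")
    case True
    have "0 \<le> B" using bdd[of 0] by linarith
    then show ?thesis using True zero by (simp add: levy_weight_nonneg)
  next
    case False
    then show ?thesis
      using bdd[of x] levy_weight_ge[of x] levy_weight_pos[of 1]
      by (auto intro!: frac_le)
  qed
  ultimately have "(\<lambda>n. (LINT x|P n. levy_weight x * ?r x) / t n) \<longlonglongrightarrow> (LINT x|\<nu>. levy_weight x * ?r x)"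
    by (intro small_time_weak_limit[OF nu dist t_pos t_lim char _ _ nonzero])
  moreover have "levy_weight x * ?r x = f x" for x
    using levy_weight_pos[of x] zero[of x] by (cases "x = 0") auto
  ultimately show ?thesis by simp
qed

text \<open>The sine does not vanish to fourth order at 0, so the weak limit does not cover it; its
  limit is the imaginary part of the exponent, which is where the drift enters.\<close>

lemma small_time_sin:
  "(\<lambda>n. (LINT x|P n. sin (u * x)) / t n) \<longlonglongrightarrow> b * u + (LINT x|\<nu>. sin (u * x) - u * x * indicator {-1..1} x)"
proof -
  have "Im (char (P n) u) = (LINT x|P n. sin (u * x))" for n
  proof -
    interpret real_distribution "P n" by (rule dist)
    show ?thesis
      unfolding char_def
      by (subst integral_Im[symmetric]) (auto intro!: integrable_const_bound[where B=1] simp: Im_exp)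
  qed
  moreover have "Im (CLINT x|\<nu>. levy_integrand u x) = (LINT x|\<nu>. sin (u * x) - u * x * indicator {-1..1} x)"
    by (subst integral_Im[OF integrable_levy_integrand[OF nu], symmetric]) (simp add: levy_integrand_def Im_exp)
  ultimately show ?thesis
    using tendsto_Im[OF small_time_char[OF nu dist t_pos t_lim char, of u]]
    by (simp add: levy_exponent_eq)
qed

text \<open>Real part of the same limit: drift and truncation term are purely imaginary and drop
  out, while the Gaussian variance stays.\<close>

lemma small_time_cos:
  "(\<lambda>n. (LINT x|P n. 1 - cos (u * x)) / t n) \<longlonglongrightarrow> v * u\<^sup>2 / 2 + (LINT x|\<nu>. 1 - cos (u * x))"
proof -
  have "Re (1 - char (P n) u) = (LINT x|P n. 1 - cos (u * x))" for n
  proof -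
    interpret real_distribution "P n" by (rule dist)
    have "1 - char (P n) u = (CLINT x|P n. 1 - iexp (u * x))"
      unfolding char_def using prob_space
      by (subst Bochner_Integration.integral_diff) (auto intro!: integrable_const_bound[where B=1])
    then show ?thesis
      by (simp only:) (subst integral_Re[symmetric], auto intro!: integrable_const_bound[where B=2] order_trans[OF norm_triangle_ineq4] simp: Re_exp)
  qed
  moreover have "- Re (CLINT x|\<nu>. levy_integrand u x) = (LINT x|\<nu>. 1 - cos (u * x))"
    by (subst integral_Re[OF integrable_levy_integrand[OF nu], symmetric])
       (simp add: levy_integrand_def Re_exp flip: Bochner_Integration.integral_minus)
  moreover have "(\<lambda>n. - Re ((char (P n) u - 1) / t n)) \<longlonglongrightarrow> - Re (levy_exponent v b \<nu> u)"
    by (intro tendsto_intros tendsto_Re small_time_char[OF nu dist t_pos t_lim char])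
  ultimately show ?thesis
    by (simp add: levy_exponent_eq minus_divide_left del: minus_divide_left [symmetric])
qed

text \<open>The limit is the generator applied to \<open>min (exp x) (exp K) - 1\<close> at 0.
  Capping changes the exponential only by a call payoff, and the generator of the exponential itself
  is 0 by the martingale condition.\<close>

lemma small_time_capped_exp:
  assumes moment: "(\<integral>\<^sup>+x\<in>{x. 1 < \<bar>x\<bar>}. ennreal (exp x) \<partial>\<nu>) < \<infinity>"
    and martingale: "b + v / 2 + (LINT x|\<nu>. exp x - 1 - x * indicator {-1..1} x) = 0"
    and K: "0 < K"
  shows "(\<lambda>n. ((LINT x|P n. min (exp x) (exp K)) - 1) / t n) \<longlonglongrightarrow> - (LINT x|\<nu>. max (exp x - exp K) 0)"
proof -
  note s [measurable_cong] = sets_levy_measure[OF nu]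
  let ?r = "capped_exp_quotient K"
  obtain B where B: "\<And>x. \<bar>?r x\<bar> \<le> B"
    using bounded_capped_exp_quotient[OF K] by metis
  have [measurable]: "?r \<in> borel_measurable borel"
    using isCont_capped_exp_quotient[OF K]
    by (intro borel_measurable_continuous_onI continuous_at_imp_continuous_on) auto
  have wr: "norm (levy_weight x * ?r x) \<le> B * min 1 (x\<^sup>2)" for x
    using mult_mono[OF levy_weight_le[of x] B[of x]] levy_weight_nonneg[of x]
    by (simp add: abs_mult mult.commute min_def)
  let ?s = "\<lambda>u x::real. sin (u * x) - u * x * indicator {-1..1} x"
  have int_s: "integrable \<nu> (?s u)" for u
    using integrable_Im[OF integrable_levy_integrand[OF nu, of u]] by (simp add: levy_integrand_def Im_exp)
  have ic: "integrable \<nu> (\<lambda>x. 1 - cos x)"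
    using integrable_minus[OF integrable_Re[OF integrable_levy_integrand[OF nu, of 1]]]
    by (simp add: levy_integrand_def Re_exp)
  have ir: "integrable \<nu> (\<lambda>x. levy_weight x * ?r x)"
    by (rule integrable_levy_measureI[OF nu _ wr]) measurable
  have "(\<lambda>n. 5 / 3 * ((LINT x|P n. sin (1 * x)) / t n) - 1 / 3 * ((LINT x|P n. sin (2 * x)) / t n)
      + (LINT x|P n. 1 - cos (1 * x)) / t n + (LINT x|P n. levy_weight x * ?r x) / t n)
    \<longlonglongrightarrow> 5 / 3 * (b * 1 + (LINT x|\<nu>. ?s 1 x)) - 1 / 3 * (b * 2 + (LINT x|\<nu>. ?s 2 x))
      + (v * 1\<^sup>2 / 2 + (LINT x|\<nu>. 1 - cos (1 * x))) + (LINT x|\<nu>. levy_weight x * ?r x)"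
    by (intro tendsto_intros small_time_sin small_time_cos
      small_time_weak_limit[OF nu dist t_pos t_lim char isCont_capped_exp_quotient[OF K] B nonzero])
  also have "(\<lambda>n. 5 / 3 * ((LINT x|P n. sin (1 * x)) / t n) - 1 / 3 * ((LINT x|P n. sin (2 * x)) / t n)
      + (LINT x|P n. 1 - cos (1 * x)) / t n + (LINT x|P n. levy_weight x * ?r x) / t n) =
      (\<lambda>n. ((LINT x|P n. min (exp x) (exp K)) - 1) / t n)"
  proof
    fix n
    interpret real_distribution "P n" by (rule dist)
    have i: "integrable (P n) (\<lambda>x. sin (1 * x))" "integrable (P n) (\<lambda>x. sin (2 * x))"
      "integrable (P n) (\<lambda>x. 1 - cos (1 * x))" "integrable (P n) (\<lambda>x. levy_weight x * ?r x)"
      "integrable (P n) (\<lambda>x. min (exp x) (exp K))"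
    proof -
      have "norm (levy_weight x * ?r x) \<le> B" for x
        using wr[of x] B[of x] by (simp add: min_def split: if_splits)
           (smt (verit) mult_left_le)
      then show "integrable (P n) (\<lambda>x. levy_weight x * ?r x)"
        by (intro integrable_const_bound[where B=B]) auto
      show "integrable (P n) (\<lambda>x. 1 - cos (1 * x))"
        by (intro Bochner_Integration.integrable_diff integrable_const integrable_const_bound[where B=1]) auto
      show "integrable (P n) (\<lambda>x. sin (1 * x))" "integrable (P n) (\<lambda>x. sin (2 * x))"
        by (intro integrable_const_bound[where B=1], auto)+
      show "integrable (P n) (\<lambda>x. min (exp x) (exp K))"
        by (intro integrable_const_bound[where B="exp K"]) auto
    qed
    have "(LINT x|P n. min (exp x) (exp K)) - 1 = (LINT x|P n. min (exp x) (exp K) - 1)"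
      using i(5) prob_space by simp
    also have "\<dots> = (LINT x|P n. 5 / 3 * sin (1 * x) - 1 / 3 * sin (2 * x) + (1 - cos (1 * x)) + levy_weight x * ?r x)"
      by (simp only: capped_exp_decomposition[OF K] trig_approx_def mult_1)
    also have "\<dots> = 5 / 3 * (LINT x|P n. sin (1 * x)) - 1 / 3 * (LINT x|P n. sin (2 * x))
        + (LINT x|P n. 1 - cos (1 * x)) + (LINT x|P n. levy_weight x * ?r x)"
      using i by (simp only: Bochner_Integration.integral_add Bochner_Integration.integral_diff integrable_mult_right
        Bochner_Integration.integrable_diff Bochner_Integration.integrable_add integral_mult_right_zero)
    finally show "5 / 3 * ((LINT x|P n. sin (1 * x)) / t n) - 1 / 3 * ((LINT x|P n. sin (2 * x)) / t n)
      + (LINT x|P n. 1 - cos (1 * x)) / t n + (LINT x|P n. levy_weight x * ?r x) / t n =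
      ((LINT x|P n. min (exp x) (exp K)) - 1) / t n"
      by (simp only: add_divide_distrib diff_divide_distrib times_divide_eq_right)
  qed
  \<comment> \<open>The slope \<open>5/3 - 2/3 = 1\<close> of the sines reproduces \<open>b\<close>,
    and the cosine reproduces \<open>v / 2\<close>: exactly the local terms of the martingale
    condition.\<close>
  also have "5 / 3 * (b * 1 + (LINT x|\<nu>. ?s 1 x)) - 1 / 3 * (b * 2 + (LINT x|\<nu>. ?s 2 x))
      + (v * 1\<^sup>2 / 2 + (LINT x|\<nu>. 1 - cos (1 * x))) + (LINT x|\<nu>. levy_weight x * ?r x) =
      b + v / 2 + (LINT x|\<nu>. 5 / 3 * ?s 1 x - 1 / 3 * ?s 2 x + (1 - cos x) + levy_weight x * ?r x)"
  proof -
    have "(LINT x|\<nu>. 5 / 3 * ?s 1 x - 1 / 3 * ?s 2 x + (1 - cos x) + levy_weight x * ?r x) =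
        5 / 3 * (LINT x|\<nu>. ?s 1 x) - 1 / 3 * (LINT x|\<nu>. ?s 2 x) + (LINT x|\<nu>. 1 - cos x)
        + (LINT x|\<nu>. levy_weight x * ?r x)"
      by (simp only: Bochner_Integration.integral_add Bochner_Integration.integral_diff integrable_mult_right
        Bochner_Integration.integrable_diff[OF integrable_mult_right[OF int_s] integrable_mult_right[OF int_s]]
        Bochner_Integration.integrable_add integral_mult_right_zero int_s ic ir)
    then show ?thesis by (simp add: add_divide_distrib)
  qed
  also have "(LINT x|\<nu>. 5 / 3 * ?s 1 x - 1 / 3 * ?s 2 x + (1 - cos x) + levy_weight x * ?r x) =
      (LINT x|\<nu>. (exp x - 1 - x * indicator {-1..1} x) - max (exp x - exp K) 0)"
  proof (intro Bochner_Integration.integral_cong refl)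
    fix x
    show "5 / 3 * ?s 1 x - 1 / 3 * ?s 2 x + (1 - cos x) + levy_weight x * ?r x =
      (exp x - 1 - x * indicator {-1..1} x) - max (exp x - exp K) 0"
      using capped_exp_decomposition[OF K, of x]
      by (simp add: trig_approx_def min_def max_def diff_divide_distrib split: if_splits)
  qed
  also have "\<dots> = (LINT x|\<nu>. exp x - 1 - x * indicator {-1..1} x) - (LINT x|\<nu>. max (exp x - exp K) 0)"
    using integrable_exp_levy_integrand[OF nu moment] integrable_call_payoff[OF nu moment K]
    by (rule Bochner_Integration.integral_diff)
  also have "b + v / 2 + \<dots> = - (LINT x|\<nu>. max (exp x - exp K) 0)"
    using martingale by simp
  finally show ?thesis .
qed

end

section \<open>The martingale property and the call price\<close>

lemma has_levy_tripletD:
  assumes "has_levy_triplet M X v b \<nu>"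
  shows "levy_process M X" "levy_measure \<nu>" "prob_space M"
    and "\<And>t. 0 \<le> t \<Longrightarrow> X t \<in> borel_measurable M"
    and "\<And>t. 0 \<le> t \<Longrightarrow> real_distribution (distr M borel (X t))"
    and "\<And>t u. 0 \<le> t \<Longrightarrow> char (distr M borel (X t)) u = exp (of_real t * levy_exponent v b \<nu> u)"
proof -
  show *: "levy_process M X" "levy_measure \<nu>" "prob_space M" and m: "\<And>t. 0 \<le> t \<Longrightarrow> X t \<in> borel_measurable M"
    using assms by (auto simp: has_levy_triplet_def levy_process_def)
  show "real_distribution (distr M borel (X t))" if "0 \<le> t" for t
    using m[OF that] \<open>prob_space M\<close> by (intro prob_space.real_distribution_distr)
  show "char (distr M borel (X t)) u = exp (of_real t * levy_exponent v b \<nu> u)" if "0 \<le> t" for t u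
  proof -
    have "char (distr M borel (X t)) u = (CLINT \<omega>|M. iexp (u * X t \<omega>))"
      unfolding char_def using m[OF that] by (subst integral_distr) auto
    then show ?thesis
      using assms that by (simp only: has_levy_triplet_def)
  qed
qed

text \<open>A continuous majorant of the indicator of \<open>x >= K\<close>, as weak convergence
  needs continuity. The ramp lies on \<open>[K - 1, K]\<close>, so for \<open>K >= 2\<close> the
  function vanishes on \<open>[-1, 1]\<close> and \<open>small_time_limit_vanishing\<close>
  applies.\<close>

definition jump_cutoff :: "real \<Rightarrow> real \<Rightarrow> real" where
  "jump_cutoff K x = max 0 (min 1 (x - K + 1))"

lemma jump_cutoff_nonneg: "0 \<le> jump_cutoff K x"
  and jump_cutoff_le_1: "jump_cutoff K x \<le> 1"
  and jump_cutoff_eq_1: "K \<le> x \<Longrightarrow> jump_cutoff K x = 1"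
  and jump_cutoff_eq_0: "x \<le> K - 1 \<Longrightarrow> jump_cutoff K x = 0"
  and isCont_jump_cutoff: "isCont (jump_cutoff K) x"
  by (auto simp: jump_cutoff_def[abs_def] intro!: continuous_intros)

lemma jump_cutoff_measurable [measurable]: "jump_cutoff K \<in> borel_measurable borel"
  unfolding jump_cutoff_def[abs_def] by measurable

lemma jump_cutoff_integral_tendsto:
  assumes nu: "levy_measure \<nu>"
  shows "(\<lambda>j. LINT x|\<nu>. jump_cutoff (real j + 2) x) \<longlonglongrightarrow> 0"
proof -
  note [measurable_cong] = sets_levy_measure[OF nu]
  have "(\<lambda>j. LINT x|\<nu>. jump_cutoff (real j + 2) x) \<longlonglongrightarrow> (LINT x|\<nu>. 0)"
  proof (rule integral_dominated_convergence[where w="\<lambda>x. min 1 (x\<^sup>2)"])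
    show "AE x in \<nu>. norm (jump_cutoff (real j + 2) x) \<le> min 1 (x\<^sup>2)" for j
    proof (intro AE_I2)
      fix x
      show "norm (jump_cutoff (real j + 2) x) \<le> min 1 (x\<^sup>2)"
      proof (cases "x \<le> 1")
        case False
        then have "1 \<le> x\<^sup>2" by (simp add: one_le_power)
        then show ?thesis using jump_cutoff_le_1 jump_cutoff_nonneg by simp
      qed (simp add: jump_cutoff_eq_0)
    qed
    show "AE x in \<nu>. (\<lambda>j. jump_cutoff (real j + 2) x) \<longlonglongrightarrow> 0"
    proof (intro AE_I2)
      fix x
      have "\<forall>\<^sub>F j in sequentially. x \<le> real j"
        by (rule eventually_sequentiallyI[of "nat \<lceil>x\<rceil>"]) linarith
      then have "\<forall>\<^sub>F j in sequentially. jump_cutoff (real j + 2) x = 0"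
        by eventually_elim (simp add: jump_cutoff_eq_0)
      then show "(\<lambda>j. jump_cutoff (real j + 2) x) \<longlonglongrightarrow> 0"
        by (rule tendsto_eventually)
    qed
  qed (use integrable_levy_measure_min[OF nu] in auto)
  then show ?thesis by simp
qed

lemma call_payoff_integral_tendsto:
  assumes nu: "levy_measure \<nu>"
    and moment: "(\<integral>\<^sup>+x\<in>{x. 1 < \<bar>x\<bar>}. ennreal (exp x) \<partial>\<nu>) < \<infinity>"
  shows "(\<lambda>j. LINT x|\<nu>. max (exp x - exp (real j + 2)) 0) \<longlonglongrightarrow> 0"
proof -
  note [measurable_cong] = sets_levy_measure[OF nu]
  have "(\<lambda>j. LINT x|\<nu>. max (exp x - exp (real j + 2)) 0) \<longlonglongrightarrow> (LINT x|\<nu>. 0)"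
  proof (rule integral_dominated_convergence[where w="\<lambda>x. max (exp x - exp 1) 0"])
    show "AE x in \<nu>. norm (max (exp x - exp (real j + 2)) 0) \<le> max (exp x - exp 1) 0" for j
    proof (intro AE_I2)
      fix x
      have "exp (1::real) \<le> exp (real j + 2)" by simp
      then show "norm (max (exp x - exp (real j + 2)) 0) \<le> max (exp x - exp 1) 0"
        by (simp add: max_def)
    qed
    show "AE x in \<nu>. (\<lambda>j. max (exp x - exp (real j + 2)) 0) \<longlonglongrightarrow> 0"
    proof (intro AE_I2)
      fix x :: real
      have "\<forall>\<^sub>F j in sequentially. x \<le> real j"
        by (rule eventually_sequentiallyI[of "nat \<lceil>x\<rceil>"]) linarith
      then have "\<forall>\<^sub>F j in sequentially. max (exp x - exp (real j + 2)) 0 = 0"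
        by eventually_elim simp
      then show "(\<lambda>j. max (exp x - exp (real j + 2)) 0) \<longlonglongrightarrow> 0"
        by (rule tendsto_eventually)
    qed
  qed (use integrable_call_payoff[OF nu moment, of 1] in auto)
  then show ?thesis by simp
qed

context
  fixes M :: "'a measure" and X :: "real \<Rightarrow> 'a \<Rightarrow> real" and v b :: real and \<nu> :: "real measure"
  assumes triplet: "has_levy_triplet M X v b \<nu>"
    and moment: "(\<integral>\<^sup>+x\<in>{x. 1 < \<bar>x\<bar>}. ennreal (exp x) \<partial>\<nu>) < \<infinity>"
    and martingale: "b + v / 2 + (LINT x|\<nu>. exp x - 1 - x * indicator {-1..1} x) = 0"
    and nonzero: "0 < (LINT x|\<nu>. levy_weight x)"
begin

interpretation prob_space M
  by (rule has_levy_tripletD(3)[OF triplet])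

lemma levy_capped_exp_limit:
  assumes t: "\<And>n. 0 < t n" "t \<longlonglongrightarrow> 0" and K: "0 < K"
  shows "(\<lambda>n. (expectation (\<lambda>\<omega>. min (exp (X (t n) \<omega>)) (exp K)) - 1) / t n)
    \<longlonglongrightarrow> - (LINT x|\<nu>. max (exp x - exp K) 0)"
proof -
  have le: "0 \<le> t n" for n using t(1)[of n] by simp
  have "expectation (\<lambda>\<omega>. min (exp (X (t n) \<omega>)) (exp K)) =
      (LINT x|distr M borel (X (t n)). min (exp x) (exp K))" for n
    using has_levy_tripletD(4)[OF triplet le] by (subst integral_distr) auto
  then show ?thesis
    using small_time_capped_exp[OF has_levy_tripletD(2)[OF triplet] has_levy_tripletD(5)[OF triplet le] t
      has_levy_tripletD(6)[OF triplet le] nonzero moment martingale K]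
    by simp
qed

lemma levy_jump_limit:
  assumes t: "\<And>n. 0 < t n" "t \<longlonglongrightarrow> 0" and K: "2 \<le> K"
  shows "(\<lambda>n. expectation (\<lambda>\<omega>. jump_cutoff K (X (t n) \<omega>)) / t n) \<longlonglongrightarrow> (LINT x|\<nu>. jump_cutoff K x)"
proof -
  have le: "0 \<le> t n" for n using t(1)[of n] by simp
  have "expectation (\<lambda>\<omega>. jump_cutoff K (X (t n) \<omega>)) = (LINT x|distr M borel (X (t n)). jump_cutoff K x)" for n
    using has_levy_tripletD(4)[OF triplet le] by (subst integral_distr) auto
  moreover have "\<bar>jump_cutoff K x\<bar> \<le> 1" for x
    using jump_cutoff_nonneg[of K x] jump_cutoff_le_1[of K x] by simp
  moreover have "jump_cutoff K x = 0" if "\<bar>x\<bar> \<le> 1" for x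
    using that K by (intro jump_cutoff_eq_0) auto
  ultimately show ?thesis
    using small_time_limit_vanishing[OF has_levy_tripletD(2)[OF triplet] has_levy_tripletD(5)[OF triplet le] t
      has_levy_tripletD(6)[OF triplet le] nonzero isCont_jump_cutoff, of K 1]
    by simp
qed

text \<open>Capping the jumps of size above \<open>K\<close> along a mesh of width \<open>t / n\<close>: the capped product of
  increments has expectation tending to \<open>exp (- t c)\<close> with \<open>c\<close> small for large \<open>K\<close>, and with
  probability close to 1 no increment is capped.\<close>

lemma levy_exp_martingale:
  assumes t: "0 < t"
  shows "integrable M (\<lambda>\<omega>. exp (X t \<omega>))" "expectation (\<lambda>\<omega>. exp (X t \<omega>)) = 1"
proof -
  note lp = has_levy_tripletD(1)[OF triplet] and nu = has_levy_tripletD(2)[OF triplet]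
  define s where "s n = t / real (Suc n)" for n
  define D where "D n i \<omega> = X (s n * real (Suc i)) \<omega> - X (s n * real i) \<omega>" for n i \<omega>
  define m where "m K n = expectation (\<lambda>\<omega>. min (exp (X (s n) \<omega>)) (exp K))" for K n
  define c where "c K = (LINT x|\<nu>. max (exp x - exp K) 0)" for K
  define q where "q K = (LINT x|\<nu>. jump_cutoff K x)" for K
  have s: "0 < s n" for n using t by (simp add: s_def)
  then have s0: "0 \<le> s n" for n by (simp add: less_imp_le)
  have s_lim: "s \<longlonglongrightarrow> 0"
    unfolding s_def using LIMSEQ_Suc[OF lim_const_over_n[of t]] by simp
  have X [measurable]: "X r \<in> borel_measurable M" if "0 \<le> r" for r
    using that by (rule has_levy_tripletD(4)[OF triplet])
  have D_meas [measurable]: "D n i \<in> borel_measurable M" for n i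
  proof -
    have "X (s n * real (Suc i)) \<in> borel_measurable M" "X (s n * real i) \<in> borel_measurable M"
      using s0[of n] by (auto intro!: X)
    then show ?thesis unfolding D_def by measurable
  qed
  have indep: "indep_vars (\<lambda>_. borel) (D n) {..<Suc n}" for n
  proof -
    have "indep_vars (\<lambda>_. borel) (\<lambda>i \<omega>. X ((\<lambda>i. s n * real i) (Suc i)) \<omega> - X ((\<lambda>i. s n * real i) i) \<omega>) {..<Suc n}"
    proof -
      have "\<forall>n (\<tau> :: nat \<Rightarrow> real). 0 \<le> \<tau> 0 \<longrightarrow> (\<forall>i<n. \<tau> i \<le> \<tau> (Suc i)) \<longrightarrow>
          indep_vars (\<lambda>_. borel) (\<lambda>i \<omega>. X (\<tau> (Suc i)) \<omega> - X (\<tau> i) \<omega>) {..<n}"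
        using lp unfolding levy_process_def by blast
      from this[rule_format, of "\<lambda>i. s n * real i" "Suc n"] show ?thesis
        using s0[of n] by (simp add: mult_left_mono)
    qed
    then show ?thesis by (simp add: D_def[abs_def])
  qed
  have D_law: "distr M borel (D n i) = distr M borel (X (s n))" for n i
  proof -
    have "distr M borel (\<lambda>\<omega>. X (s n * real i + s n) \<omega> - X (s n * real i) \<omega>) = distr M borel (X (s n))"
      using lp s0[of n] unfolding levy_process_def by simp
    then show ?thesis by (simp add: D_def[abs_def] algebra_simps)
  qed
  have D_exp: "expectation (\<lambda>\<omega>. f (D n i \<omega>)) = expectation (\<lambda>\<omega>. f (X (s n) \<omega>))"
    if [measurable]: "f \<in> borel_measurable borel" for f :: "real \<Rightarrow> real" and n i
    using arg_cong[OF D_law[of n i], of "\<lambda>P. integral\<^sup>L P f"] X[OF s0, of n]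
    by (simp add: integral_distr)
  have D_sum: "AE \<omega> in M. (\<Sum>i<Suc n. D n i \<omega>) = X t \<omega>" for n
  proof -
    have "(\<Sum>i<Suc n. D n i \<omega>) = X t \<omega> - X 0 \<omega>" for \<omega>
      unfolding D_def by (subst sum_lessThan_telescope) (simp add: s_def)
    moreover have "AE \<omega> in M. X 0 \<omega> = 0"
      using lp by (simp add: levy_process_def)
    ultimately show ?thesis by (auto elim: eventually_mono)
  qed
  let ?p = "\<lambda>K n \<omega>. \<Prod>i<Suc n. min (exp (D n i \<omega>)) (exp K)"
  have int_min: "integrable M (\<lambda>\<omega>. min (exp (D n i \<omega>)) (exp K))" for n i K
    by (intro integrable_const_bound[where B="exp K"]) auto
  have ind: "indep_vars (\<lambda>_. borel) (\<lambda>i \<omega>. min (exp (D n i \<omega>)) (exp K)) {..<Suc n}" for n K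
    using indep by (rule indep_vars_compose2) measurable
  have p_int: "integrable M (?p K n)" for K n
    using ind int_min by (intro indep_vars_integrable) auto
  have p_exp: "expectation (?p K n) = m K n ^ Suc n" for K n
  proof -
    have "expectation (?p K n) = (\<Prod>i<Suc n. expectation (\<lambda>\<omega>. min (exp (D n i \<omega>)) (exp K)))"
      using ind int_min by (intro indep_vars_lebesgue_integral) auto
    also have "\<dots> = (\<Prod>i<Suc n. m K n)"
      unfolding m_def by (intro prod.cong refl D_exp) measurable
    finally show ?thesis by simp
  qed
  have m_nonneg: "0 \<le> m K n" for K n
    unfolding m_def by (intro integral_nonneg_AE) auto
  \<comment> \<open>Converts limits per unit of time over a mesh step into limits for the sum over
    all \<open>Suc n\<close> increments.\<close>
  have scale: "t * (z / s n) = real (Suc n) * z" for z n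
    using t by (simp add: s_def)
  have m_lim: "(\<lambda>n. real (Suc n) * (m K n - 1)) \<longlonglongrightarrow> - (t * c K)" if "2 \<le> K" for K
  proof -
    have "(\<lambda>n. t * ((m K n - 1) / s n)) \<longlonglongrightarrow> t * (- c K)"
      unfolding m_def c_def using that by (intro tendsto_intros levy_capped_exp_limit s s_lim) auto
    then show ?thesis by (simp only: scale mult_minus_right)
  qed
  have q_lim: "(\<lambda>n. real (Suc n) * expectation (\<lambda>\<omega>. jump_cutoff K (X (s n) \<omega>))) \<longlonglongrightarrow> t * q K" if "2 \<le> K" for K
  proof -
    have "(\<lambda>n. t * (expectation (\<lambda>\<omega>. jump_cutoff K (X (s n) \<omega>)) / s n)) \<longlonglongrightarrow> t * q K"
      unfolding q_def using that by (intro tendsto_intros levy_jump_limit s s_lim) auto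
    then show ?thesis by (simp only: scale)
  qed
  have c_nonneg: "0 \<le> c K" for K
    unfolding c_def by (intro integral_nonneg_AE) auto
  have c_lim: "(\<lambda>j. c (real j + 2)) \<longlonglongrightarrow> 0"
    unfolding c_def by (rule call_payoff_integral_tendsto[OF nu moment])
  have q_lim0: "(\<lambda>j. q (real j + 2)) \<longlonglongrightarrow> 0"
    unfolding q_def by (rule jump_cutoff_integral_tendsto[OF nu])
  have Xt [measurable]: "X t \<in> borel_measurable M"
    using t by (intro X) simp
  \<comment> \<open>The extra cap \<open>A\<close> limits the cost of a large jump to
    \<open>A\<close> times its probability, which the union bound over the increments estimates by
    \<open>t * q K\<close> in the limit.\<close>
  have upper: "expectation (\<lambda>\<omega>. min (exp (X t \<omega>)) A) \<le> 1 + A * (t * q K)" if A: "0 \<le> A" and K: "2 \<le> K" for A K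
  proof (rule LIMSEQ_le_const)
    \<comment> \<open>The last summand is nonnegative slack, chosen so that the limit is exactly
      \<open>1 + A * (t * q K)\<close>.\<close>
    show "(\<lambda>n. exp (real (Suc n) * (m K n - 1))
        + A * (real (Suc n) * expectation (\<lambda>\<omega>. jump_cutoff K (X (s n) \<omega>))) + (1 - exp (- (t * c K))))
        \<longlonglongrightarrow> 1 + A * (t * q K)"
      by (rule tendsto_eq_intros m_lim q_lim K refl | simp)+
    have "expectation (\<lambda>\<omega>. min (exp (X t \<omega>)) A) \<le> exp (real (Suc n) * (m K n - 1))
        + A * (real (Suc n) * expectation (\<lambda>\<omega>. jump_cutoff K (X (s n) \<omega>)))" for n
    proof -
      have int_j: "integrable M (\<lambda>\<omega>. jump_cutoff K (D n i \<omega>))" for i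
        by (intro integrable_const_bound[where B=1]) (auto simp: jump_cutoff_nonneg jump_cutoff_le_1)
      have "expectation (\<lambda>\<omega>. min (exp (X t \<omega>)) A) \<le>
          expectation (\<lambda>\<omega>. ?p K n \<omega> + A * (\<Sum>i<Suc n. jump_cutoff K (D n i \<omega>)))"
      proof (rule integral_mono_AE)
        show "integrable M (\<lambda>\<omega>. min (exp (X t \<omega>)) A)"
          using A by (intro integrable_const_bound[where B="A"]) (auto simp: min_def intro: less_imp_le)
        show "integrable M (\<lambda>\<omega>. ?p K n \<omega> + A * (\<Sum>i<Suc n. jump_cutoff K (D n i \<omega>)))"
          using p_int int_j by (intro Bochner_Integration.integrable_add integrable_mult_right Bochner_Integration.integrable_sum) auto
        show "AE \<omega> in M. min (exp (X t \<omega>)) A \<le> ?p K n \<omega> + A * (\<Sum>i<Suc n. jump_cutoff K (D n i \<omega>))"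
          using D_sum[of n]
        proof eventually_elim
          case (elim \<omega>)
          have p0: "0 \<le> ?p K n \<omega>" by (intro prod_nonneg) auto
          show ?case
          \<comment> \<open>Either no increment is capped and the product equals
            \<open>exp (X t)\<close>, or some cutoff equals 1 and the second summand alone reaches
            \<open>A\<close>.\<close>
          proof (cases "\<forall>i<Suc n. D n i \<omega> \<le> K")
            case True
            then have "?p K n \<omega> = (\<Prod>i<Suc n. exp (D n i \<omega>))"
              by (intro prod.cong) auto
            also have "\<dots> = exp (X t \<omega>)"
              by (simp only: exp_sum[OF finite_lessThan, symmetric] elim)
            finally have "min (exp (X t \<omega>)) A \<le> ?p K n \<omega>" by simp
            moreover have "0 \<le> A * (\<Sum>i<Suc n. jump_cutoff K (D n i \<omega>))"
              using A by (intro mult_nonneg_nonneg sum_nonneg jump_cutoff_nonneg)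
            ultimately show ?thesis by linarith
          next
            case False
            then obtain i where i: "i < Suc n" "K \<le> D n i \<omega>"
              by (meson linear)
            have "1 = jump_cutoff K (D n i \<omega>)"
              using i by (simp add: jump_cutoff_eq_1)
            also have "\<dots> \<le> (\<Sum>i<Suc n. jump_cutoff K (D n i \<omega>))"
              using i by (intro member_le_sum jump_cutoff_nonneg) auto
            finally have "A * 1 \<le> A * (\<Sum>i<Suc n. jump_cutoff K (D n i \<omega>))"
              using A by (rule mult_left_mono)
            then show ?thesis using p0 by linarith
          qed
        qed
      qed
      also have "\<dots> = m K n ^ Suc n + A * (\<Sum>i<Suc n. expectation (\<lambda>\<omega>. jump_cutoff K (D n i \<omega>)))"
        using p_int int_j p_exp
        by (subst Bochner_Integration.integral_add) (auto simp del: sum.lessThan_Suc prod.lessThan_Suc power_Suc)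
      also have "(\<Sum>i<Suc n. expectation (\<lambda>\<omega>. jump_cutoff K (D n i \<omega>))) =
          real (Suc n) * expectation (\<lambda>\<omega>. jump_cutoff K (X (s n) \<omega>))"
        by (simp only: D_exp jump_cutoff_measurable sum_constant card_lessThan)
      also have "m K n ^ Suc n \<le> exp (m K n - 1) ^ Suc n"
        using m_nonneg exp_ge_add_one_self[of "m K n - 1"] by (intro power_mono) auto
      also have "exp (m K n - 1) ^ Suc n = exp (real (Suc n) * (m K n - 1))"
        by (rule exp_of_nat_mult[symmetric])
      finally show ?thesis by simp
    qed
    moreover have "exp (- (t * c K)) \<le> 1"
      using t c_nonneg[of K] by simp
    ultimately show "\<exists>N. \<forall>n\<ge>N. expectation (\<lambda>\<omega>. min (exp (X t \<omega>)) A) \<le> exp (real (Suc n) * (m K n - 1))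
        + A * (real (Suc n) * expectation (\<lambda>\<omega>. jump_cutoff K (X (s n) \<omega>))) + (1 - exp (- (t * c K)))"
      by (intro exI[of _ 0]) (smt (verit))
  qed
  \<comment> \<open>First \<open>K\<close> tends to infinity with \<open>A\<close> fixed, which
    removes the jump term; only afterwards does Fatou's lemma let \<open>A\<close> grow.\<close>
  have capped: "expectation (\<lambda>\<omega>. min (exp (X t \<omega>)) A) \<le> 1" if A: "0 \<le> A" for A
  proof (rule LIMSEQ_le_const)
    show "(\<lambda>j. 1 + A * (t * q (real j + 2))) \<longlonglongrightarrow> 1"
      by (rule tendsto_eq_intros q_lim0 refl | simp)+
  qed (use upper[OF A] in auto)
  have nn: "(\<integral>\<^sup>+\<omega>. ennreal (exp (X t \<omega>)) \<partial>M) \<le> 1"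
  proof -
    have "(\<integral>\<^sup>+\<omega>. ennreal (exp (X t \<omega>)) \<partial>M) = (\<integral>\<^sup>+\<omega>. liminf (\<lambda>j. ennreal (min (exp (X t \<omega>)) (real j))) \<partial>M)"
    proof (intro nn_integral_cong)
      fix \<omega>
      have "\<forall>\<^sub>F j in sequentially. exp (X t \<omega>) \<le> real j"
        by (rule eventually_sequentiallyI[of "nat \<lceil>exp (X t \<omega>)\<rceil>"]) linarith
      then have "\<forall>\<^sub>F j in sequentially. ennreal (min (exp (X t \<omega>)) (real j)) = ennreal (exp (X t \<omega>))"
        by eventually_elim simp
      then have "(\<lambda>j. ennreal (min (exp (X t \<omega>)) (real j))) \<longlonglongrightarrow> ennreal (exp (X t \<omega>))"
        by (rule tendsto_eventually)
      then show "ennreal (exp (X t \<omega>)) = liminf (\<lambda>j. ennreal (min (exp (X t \<omega>)) (real j)))"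
        by (intro lim_imp_Liminf[symmetric]) auto
    qed
    also have "\<dots> \<le> liminf (\<lambda>j. \<integral>\<^sup>+\<omega>. ennreal (min (exp (X t \<omega>)) (real j)) \<partial>M)"
      by (intro nn_integral_liminf) measurable
    also have "\<dots> \<le> liminf (\<lambda>j. 1)"
    proof (intro Liminf_mono always_eventually allI)
      fix j
      have "(\<integral>\<^sup>+\<omega>. ennreal (min (exp (X t \<omega>)) (real j)) \<partial>M) = ennreal (expectation (\<lambda>\<omega>. min (exp (X t \<omega>)) (real j)))"
        by (intro nn_integral_eq_integral integrable_const_bound[where B="real j"]) auto
      also have "\<dots> \<le> ennreal 1"
        by (intro ennreal_leI capped) auto
      finally show "(\<integral>\<^sup>+\<omega>. ennreal (min (exp (X t \<omega>)) (real j)) \<partial>M) \<le> 1"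
        by simp
    qed
    also have "\<dots> = 1" by (simp add: Liminf_const)
    finally show ?thesis .
  qed
  show int: "integrable M (\<lambda>\<omega>. exp (X t \<omega>))"
    using nn by (simp add: integrable_iff_bounded le_less_trans[OF _ ennreal_one_less_top])
  show "expectation (\<lambda>\<omega>. exp (X t \<omega>)) = 1"
  proof (rule antisym)
    have "ennreal (expectation (\<lambda>\<omega>. exp (X t \<omega>))) \<le> ennreal 1"
      using nn_integral_eq_integral[OF int] nn by simp
    then show "expectation (\<lambda>\<omega>. exp (X t \<omega>)) \<le> 1"
      by (simp add: ennreal_le_iff del: ennreal_1)
    \<comment> \<open>Capping only decreases the product of exponentials, and Bernoulli's inequality
      bounds the power \<open>m K n ^ Suc n\<close> below by an expression with a known
      limit.\<close>
    have lower: "1 - t * c K \<le> expectation (\<lambda>\<omega>. exp (X t \<omega>))" if "2 \<le> K" for K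
    proof (rule LIMSEQ_le_const2)
      show "(\<lambda>n. 1 + real (Suc n) * (m K n - 1)) \<longlonglongrightarrow> 1 - t * c K"
        by (rule tendsto_eq_intros m_lim that refl | simp)+
      have "1 + real (Suc n) * (m K n - 1) \<le> expectation (\<lambda>\<omega>. exp (X t \<omega>))" for n
      proof -
        have "1 + real (Suc n) * (m K n - 1) \<le> (1 + (m K n - 1)) ^ Suc n"
          using m_nonneg[of K n] by (intro Bernoulli_inequality) simp
        also have "\<dots> = expectation (?p K n)"
          by (simp only: p_exp) simp
        also have "\<dots> \<le> expectation (\<lambda>\<omega>. exp (X t \<omega>))"
        proof (rule integral_mono_AE[OF p_int int])
          show "AE \<omega> in M. ?p K n \<omega> \<le> exp (X t \<omega>)"
            using D_sum[of n]
          proof eventually_elim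
            case (elim \<omega>)
            have "?p K n \<omega> \<le> (\<Prod>i<Suc n. exp (D n i \<omega>))"
              by (intro prod_mono) auto
            also have "\<dots> = exp (X t \<omega>)"
              by (simp only: exp_sum[OF finite_lessThan, symmetric] elim)
            finally show ?case .
          qed
        qed
        finally show ?thesis .
      qed
      then show "\<exists>N. \<forall>n\<ge>N. 1 + real (Suc n) * (m K n - 1) \<le> expectation (\<lambda>\<omega>. exp (X t \<omega>))"
        by blast
    qed
    show "1 \<le> expectation (\<lambda>\<omega>. exp (X t \<omega>))"
    proof (rule LIMSEQ_le_const2)
      show "(\<lambda>j. 1 - t * c (real j + 2)) \<longlonglongrightarrow> 1"
        by (rule tendsto_eq_intros c_lim refl | simp)+
    qed (use lower in auto)
  qed
qed

text \<open>Since \<open>max (exp x - exp k) 0 = exp x - min (exp x) (exp k)\<close> and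
  \<open>exp (X t)\<close> has mean 1, the price is 1 minus the capped expectation. The passage to
  sequences matches the form of the weak limit.\<close>

lemma levy_call_price_asymp:
  assumes k: "0 < k"
  shows "((\<lambda>t. expectation (\<lambda>\<omega>. max (exp (X t \<omega>) - exp k) 0) / t) \<longlongrightarrow> a0 \<nu> k) (at_right 0)"
  unfolding tendsto_at_iff_sequentially comp_def
proof (intro allI impI)
  fix t :: "nat \<Rightarrow> real"
  assume "\<forall>n. t n \<in> {0<..} - {0}" and lim: "t \<longlonglongrightarrow> 0"
  then have t: "0 < t n" for n by auto
  have "expectation (\<lambda>\<omega>. max (exp (X (t n) \<omega>) - exp k) 0) =
      - (expectation (\<lambda>\<omega>. min (exp (X (t n) \<omega>)) (exp k)) - 1)" for n
  proof -
    have [measurable]: "X (t n) \<in> borel_measurable M"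
      using t[of n] by (intro has_levy_tripletD(4)[OF triplet]) simp
    have "expectation (\<lambda>\<omega>. max (exp (X (t n) \<omega>) - exp k) 0) =
      expectation (\<lambda>\<omega>. exp (X (t n) \<omega>) - min (exp (X (t n) \<omega>)) (exp k))"
      by (intro Bochner_Integration.integral_cong) (auto simp: max_def min_def)
    also have "\<dots> = expectation (\<lambda>\<omega>. exp (X (t n) \<omega>)) - expectation (\<lambda>\<omega>. min (exp (X (t n) \<omega>)) (exp k))"
      by (intro Bochner_Integration.integral_diff levy_exp_martingale t integrable_const_bound[where B="exp k"]) auto
    finally show ?thesis
      using levy_exp_martingale(2)[OF t] by simp
  qed
  then have "(\<lambda>n. expectation (\<lambda>\<omega>. max (exp (X (t n) \<omega>) - exp k) 0) / t n) =
      (\<lambda>n. - ((expectation (\<lambda>\<omega>. min (exp (X (t n) \<omega>)) (exp k)) - 1) / t n))"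
    by (simp only: minus_divide_left)
  then show "(\<lambda>n. expectation (\<lambda>\<omega>. max (exp (X (t n) \<omega>) - exp k) 0) / t n) \<longlonglongrightarrow> a0 \<nu> k"
    using tendsto_minus[OF levy_capped_exp_limit[OF t lim k]] by (simp only: minus_minus a0_def)
qed

end

text \<open>A zero integral would make \<open>f\<close> vanish almost everywhere where
  \<open>g\<close> is positive, but an interval has positive length. This supplies the nondegeneracy
  of the weighted limit and the positivity of \<open>a0\<close>.\<close>

lemma integral_density_pos:
  fixes f g :: "real \<Rightarrow> real"
  assumes int: "integrable (density lborel (\<lambda>x. ennreal (g x))) f"
    and [measurable]: "g \<in> borel_measurable borel"
    and nonneg: "\<And>x. 0 \<le> f x" and pos: "\<And>x. x \<in> {c<..<d} \<Longrightarrow> 0 < f x \<and> 0 < g x" and "c < d"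
  shows "0 < (LINT x|density lborel (\<lambda>x. ennreal (g x)). f x)"
proof (rule ccontr)
  assume "\<not> ?thesis"
  moreover have "0 \<le> (LINT x|density lborel (\<lambda>x. ennreal (g x)). f x)"
    using nonneg by (intro integral_nonneg_AE) auto
  ultimately have "(LINT x|density lborel (\<lambda>x. ennreal (g x)). f x) = 0" by linarith
  then have "AE x in density lborel (\<lambda>x. ennreal (g x)). f x = 0"
    using integral_nonneg_eq_0_iff_AE[OF int] nonneg by simp
  then have "AE x in lborel. 0 < g x \<longrightarrow> f x = 0"
    by (subst (asm) AE_density) auto
  then have "AE x in lborel. x \<notin> {c<..<d}"
    by eventually_elim (use pos in force)
  then have "emeasure lborel {c<..<d} = 0"
    by (subst (asm) AE_iff_measurable[of "{c<..<d}"]) auto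
  then show False using \<open>c < d\<close> by simp
qed

section \<open>Black--Scholes prices at small variance\<close>

lemma std_normal_cdf_has_derivative: "(Phi has_real_derivative std_normal_density x) (at x)"
proof -
  interpret N: real_distribution std_normal_distribution by (rule real_dist_normal_dist)
  \<comment> \<open>A base point strictly to the left of \<open>x\<close> makes the representation
    of \<open>Phi\<close> as an integral valid on a neighbourhood of \<open>x\<close>.\<close>
  let ?c = "x - 1"
  have eq: "Phi y = Phi ?c + (LBINT z=?c..y. std_normal_density z)" if "?c < y" for y
  proof -
    have "Phi y - Phi ?c = measure std_normal_distribution {?c<..y}"
      using that by (rule N.cdf_diff_eq)
    also have "\<dots> = (LINT z|std_normal_distribution. indicator {?c<..y} z)" by simp
    also have "\<dots> = (LINT z|lborel. std_normal_density z *\<^sub>R indicator {?c<..y} z)"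
      by (subst integral_density) auto
    also have "\<dots> = (LBINT z=?c..y. std_normal_density z)"
      using that by (simp add: interval_integral_Ioc set_lebesgue_integral_def mult.commute)
    finally show ?thesis by simp
  qed
  have "((\<lambda>u. LBINT z=?c..u. std_normal_density z) has_vector_derivative std_normal_density x)
      (at x within {x - 1..x + 1})"
    by (rule interval_integral_FTC2) (auto intro!: continuous_intros simp: std_normal_density_def)
  then have "((\<lambda>u. LBINT z=?c..u. std_normal_density z) has_real_derivative std_normal_density x) (at x)"
    by (simp add: has_real_derivative_iff_has_vector_derivative at_within_Icc_at)
  then have "((\<lambda>u. Phi ?c + (LBINT z=?c..u. std_normal_density z)) has_real_derivative std_normal_density x) (at x)"
    by (auto intro!: derivative_eq_intros)
  then show ?thesis
  proof (rule has_field_derivative_transform_within_open[where S="{?c<..}"])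
    show "Phi ?c + (LBINT z=?c..u. std_normal_density z) = Phi u" if "u \<in> {?c<..}" for u
      using eq[of u] that by simp
  qed auto
qed

text \<open>Vega with respect to the dimensionless variance rather than the volatility: the normal
  density at the first argument of \<open>bs_call\<close>, divided by
  \<open>2 * sqrt V\<close>.\<close>

definition bs_vega :: "real \<Rightarrow> real \<Rightarrow> real" where
  "bs_vega k V = 1 / (2 * sqrt (2 * pi) * sqrt V) * exp (k / 2 - k\<^sup>2 / (2 * V) - V / 8)"

lemma bs_vega_pos: "0 < V \<Longrightarrow> 0 < bs_vega k V"
  by (simp add: bs_vega_def)

text \<open>The density at the first argument equals \<open>exp k\<close> times the density at the
  second, so the derivatives of \<open>- k / sqrt V\<close> cancel and only those of
  \<open>sqrt V / 2\<close> add up.\<close>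

lemma bs_call_has_derivative:
  assumes V: "0 < V"
  shows "(bs_call k has_real_derivative bs_vega k V) (at V)"
proof -
  let ?d1 = "- k / sqrt V + sqrt V / 2" and ?d2 = "- k / sqrt V - sqrt V / 2"
  have square: "(- k / q + r * q / 2)\<^sup>2 = k\<^sup>2 / q\<^sup>2 - r * k + r\<^sup>2 * q\<^sup>2 / 4" if "q \<noteq> 0" for q r :: real
    using that by (simp add: power2_eq_square field_simps)
  have d1: "std_normal_density ?d1 = 1 / sqrt (2 * pi) * exp (k / 2 - k\<^sup>2 / (2 * V) - V / 8)"
  proof -
    have "?d1\<^sup>2 = k\<^sup>2 / V - k + V / 4"
      using V square[of "sqrt V" 1] by simp
    then have "- ?d1\<^sup>2 / 2 = k / 2 - k\<^sup>2 / (2 * V) - V / 8" by (simp add: field_simps)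
    then show ?thesis by (simp only: std_normal_density_def)
  qed
  have d2: "exp k * std_normal_density ?d2 = 1 / sqrt (2 * pi) * exp (k / 2 - k\<^sup>2 / (2 * V) - V / 8)"
  proof -
    have "?d2\<^sup>2 = k\<^sup>2 / V + k + V / 4"
      using V square[of "sqrt V" "-1"] by simp
    then have "k + - ?d2\<^sup>2 / 2 = k / 2 - k\<^sup>2 / (2 * V) - V / 8" by (simp add: field_simps)
    then show ?thesis by (simp add: std_normal_density_def flip: exp_add)
  qed
  let ?e = "1 / sqrt (2 * pi) * exp (k / 2 - k\<^sup>2 / (2 * V) - V / 8)"
  have D: "((\<lambda>V. - k / sqrt V + s * (sqrt V / 2)) has_real_derivative
      (k / (2 * V * sqrt V) + s / (4 * sqrt V))) (at V)" for s
    using V by (auto intro!: derivative_eq_intros simp: field_simps)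
  have D1: "((\<lambda>V. - k / sqrt V + sqrt V / 2) has_real_derivative
      (k / (2 * V * sqrt V) + 1 / (4 * sqrt V))) (at V)"
    using D[of 1] by simp
  have D2: "((\<lambda>V. - k / sqrt V - sqrt V / 2) has_real_derivative
      (k / (2 * V * sqrt V) - 1 / (4 * sqrt V))) (at V)"
    using D[of "-1"] by simp
  have "((\<lambda>V. Phi (- k / sqrt V + sqrt V / 2) - exp k * Phi (- k / sqrt V - sqrt V / 2)) has_real_derivative
      std_normal_density ?d1 * (k / (2 * V * sqrt V) + 1 / (4 * sqrt V))
        - exp k * (std_normal_density ?d2 * (k / (2 * V * sqrt V) - 1 / (4 * sqrt V)))) (at V)"
    by (intro DERIV_diff DERIV_cmult DERIV_chain2[OF std_normal_cdf_has_derivative] D1 D2)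
  moreover have "std_normal_density ?d1 * (k / (2 * V * sqrt V) + 1 / (4 * sqrt V))
        - exp k * (std_normal_density ?d2 * (k / (2 * V * sqrt V) - 1 / (4 * sqrt V))) = bs_vega k V"
  proof -
    have "std_normal_density ?d1 * (k / (2 * V * sqrt V) + 1 / (4 * sqrt V))
        - exp k * (std_normal_density ?d2 * (k / (2 * V * sqrt V) - 1 / (4 * sqrt V))) =
        ?e * (k / (2 * V * sqrt V) + 1 / (4 * sqrt V)) - ?e * (k / (2 * V * sqrt V) - 1 / (4 * sqrt V))"
      by (simp only: d1 d2 mult.assoc[symmetric])
    also have "\<dots> = ?e * (1 / (2 * sqrt V))"
      unfolding right_diff_distrib[symmetric] by simp
    also have "\<dots> = bs_vega k V"
      by (simp add: bs_vega_def)
    finally show ?thesis .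
  qed
  ultimately show ?thesis
    unfolding bs_call_def[abs_def] by simp
qed

lemma bs_call_strict_mono:
  assumes "0 < V" "V < W"
  shows "bs_call k V < bs_call k W"
  using assms(2)
proof (rule DERIV_pos_imp_increasing)
  fix x assume "V \<le> x" "x \<le> W"
  then show "\<exists>y. (bs_call k has_real_derivative y) (at x) \<and> 0 < y"
    using bs_call_has_derivative[of x k] bs_vega_pos[of x k] assms(1) by auto
qed

lemma bs_call_tendsto_0:
  assumes "0 < k"
  shows "(bs_call k \<longlongrightarrow> 0) (at_right 0)"
proof -
  interpret N: real_distribution std_normal_distribution by (rule real_dist_normal_dist)
  have "filterlim (\<lambda>V. - k / sqrt V + sqrt V / 2) at_bot (at_right 0)"
    "filterlim (\<lambda>V. - k / sqrt V - sqrt V / 2) at_bot (at_right 0)"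
    using assms by real_asymp+
  from this[THEN filterlim_compose[OF N.cdf_lim_at_bot]]
  have "((\<lambda>V. Phi (- k / sqrt V + sqrt V / 2) - exp k * Phi (- k / sqrt V - sqrt V / 2)) \<longlongrightarrow> 0 - exp k * 0) (at_right 0)"
    by (intro tendsto_intros)
  then show ?thesis by (simp add: bs_call_def[abs_def])
qed

lemma bs_call_pos:
  assumes "0 < k" "0 < V"
  shows "0 < bs_call k V"
proof -
  have "0 \<le> bs_call k (V / 2)"
  proof (rule tendsto_upperbound[OF bs_call_tendsto_0[OF assms(1)]])
    have "\<forall>\<^sub>F W in at_right 0. W \<in> {0<..<V / 2}"
      using assms by (intro eventually_at_right_real) simp
    then show "\<forall>\<^sub>F W in at_right 0. bs_call k W \<le> bs_call k (V / 2)"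
      by eventually_elim (auto intro!: less_imp_le bs_call_strict_mono)
  qed simp
  also have "\<dots> < bs_call k V"
    using assms by (intro bs_call_strict_mono) auto
  finally show ?thesis .
qed

text \<open>The reference price at \<open>W\<close> serves as the upper end of the intermediate
  value theorem, so the behaviour of \<open>bs_call\<close> for large variance never has to be
  known.\<close>

lemma bs_call_inverse:
  assumes k: "0 < k" and W: "0 < W" and C: "0 < C" "C < bs_call k W"
  shows "\<exists>!V. 0 < V \<and> C = bs_call k V"
proof -
  have "\<forall>\<^sub>F V in at_right 0. bs_call k V < C"
    using order_tendstoD(2)[OF bs_call_tendsto_0[OF k] C(1)] .
  moreover have "\<forall>\<^sub>F V in at_right 0. V \<in> {0<..<W}"
    using W by (rule eventually_at_right_real)
  ultimately have "\<forall>\<^sub>F V in at_right 0. bs_call k V < C \<and> 0 < V \<and> V < W"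
    by eventually_elim simp
  then obtain U where U: "bs_call k U < C" "0 < U" "U < W"
    using eventually_happens trivial_limit_at_right_real by blast
  have "\<exists>V\<ge>U. V \<le> W \<and> bs_call k V = C"
    using U C(2) bs_call_has_derivative DERIV_isCont
    by (intro IVT) (auto intro: DERIV_isCont[OF bs_call_has_derivative])
  then obtain V where V: "U \<le> V" "bs_call k V = C" by blast
  show ?thesis
  proof (rule ex1I[of _ V])
    show "0 < V \<and> C = bs_call k V" using V U by simp
    fix V' assume "0 < V' \<and> C = bs_call k V'"
    then show "V' = V"
      using V U bs_call_strict_mono[of V V' k] bs_call_strict_mono[of V' V k]
      by (cases V V' rule: linorder_cases) auto
  qed
qed

text \<open>L'Hopital's rule: the factor \<open>exp (- k^2 / (2 * V))\<close> cancels between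
  \<open>bs_vega\<close> and the derivative of the comparison function, leaving a quotient
  continuous at \<open>V = 0\<close>.\<close>

lemma bs_call_asymp:
  assumes k: "0 < k"
  shows "((\<lambda>V. bs_call k V / (V * sqrt V * exp (- k\<^sup>2 / (2 * V))))
    \<longlongrightarrow> exp (k / 2) / (sqrt (2 * pi) * k\<^sup>2)) (at_right 0)"
proof (rule lhopital_right_0)
  let ?g = "\<lambda>V. V * sqrt V * exp (- k\<^sup>2 / (2 * V))"
  let ?g' = "\<lambda>V. (3 / 2 * sqrt V + k\<^sup>2 / (2 * sqrt V)) * exp (- k\<^sup>2 / (2 * V))"
  have pos: "\<forall>\<^sub>F V in at_right 0. 0 < (V::real)"
    by (simp add: eventually_at_right_less)
  show "(bs_call k \<longlongrightarrow> 0) (at_right 0)"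
    using k by (rule bs_call_tendsto_0)
  show "(?g \<longlongrightarrow> 0) (at_right 0)"
    using k by real_asymp
  show "\<forall>\<^sub>F V in at_right 0. ?g V \<noteq> 0"
    using pos by eventually_elim simp
  show "\<forall>\<^sub>F V in at_right 0. ?g' V \<noteq> 0"
    using pos
  proof eventually_elim
    case (elim V)
    then have "0 < 3 / 2 * sqrt V + k\<^sup>2 / (2 * sqrt V)"
      by (intro add_pos_nonneg) auto
    then show ?case by simp
  qed
  show "\<forall>\<^sub>F V in at_right 0. (bs_call k has_real_derivative bs_vega k V) (at V)"
    using pos by eventually_elim (rule bs_call_has_derivative)
  show "\<forall>\<^sub>F V in at_right 0. (?g has_real_derivative ?g' V) (at V)"
    using pos
  proof eventually_elim
    case (elim V)
    have "sqrt V * sqrt V = V" using elim by simp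
    then have "k\<^sup>2 / (2 * V\<^sup>2) * (V * sqrt V) = k\<^sup>2 / (2 * sqrt V)" "V / (2 * sqrt V) = sqrt V / 2"
      using elim by (auto simp: field_simps power2_eq_square)
    moreover have "(?g has_real_derivative
        (sqrt V + V / (2 * sqrt V)) * exp (- k\<^sup>2 / (2 * V)) + k\<^sup>2 / (2 * V\<^sup>2) * (V * sqrt V) * exp (- k\<^sup>2 / (2 * V))) (at V)"
      using elim by (auto intro!: derivative_eq_intros simp: field_simps power2_eq_square)
    ultimately have "(?g has_real_derivative
        (sqrt V + sqrt V / 2) * exp (- k\<^sup>2 / (2 * V)) + k\<^sup>2 / (2 * sqrt V) * exp (- k\<^sup>2 / (2 * V))) (at V)"
      by (simp only:)
    moreover have "sqrt V + sqrt V / 2 = 3 / 2 * sqrt V" by simp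
    ultimately show ?case
      by (simp only: distrib_right)
  qed
  have "((\<lambda>V. exp (k / 2 - V / 8) / (sqrt (2 * pi) * (3 * V + k\<^sup>2))) \<longlongrightarrow>
      exp (k / 2 - 0 / 8) / (sqrt (2 * pi) * (3 * 0 + k\<^sup>2))) (at_right 0)"
    using k by (intro tendsto_intros) auto
  moreover have "\<forall>\<^sub>F V in at_right 0.
      exp (k / 2 - V / 8) / (sqrt (2 * pi) * (3 * V + k\<^sup>2)) = bs_vega k V / ?g' V"
    using pos
  proof eventually_elim
    case (elim V)
    have "exp (k / 2 - k\<^sup>2 / (2 * V) - V / 8) = exp (k / 2 - V / 8) * exp (- k\<^sup>2 / (2 * V))"
      by (simp flip: exp_add)
    then have "bs_vega k V = exp (k / 2 - V / 8) * exp (- k\<^sup>2 / (2 * V)) / (sqrt (2 * pi) * (2 * sqrt V))"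
      by (simp add: bs_vega_def)
    moreover have "?g' V = (3 * V + k\<^sup>2) / (2 * sqrt V) * exp (- k\<^sup>2 / (2 * V))"
      using elim by (simp add: field_simps)
    moreover have "3 * V + k\<^sup>2 \<noteq> 0"
      using elim zero_le_power2[of k] by linarith
    moreover have "e / (S * m) = e * E / (S * (2 * q)) / (m / (2 * q) * E)"
      if "E \<noteq> 0" "S \<noteq> 0" "q \<noteq> 0" "m \<noteq> 0" for e E S q m :: real
      using that by (simp add: field_simps)
    then have "exp (k / 2 - V / 8) / (sqrt (2 * pi) * (3 * V + k\<^sup>2)) =
        exp (k / 2 - V / 8) * exp (- k\<^sup>2 / (2 * V)) / (sqrt (2 * pi) * (2 * sqrt V))
          / ((3 * V + k\<^sup>2) / (2 * sqrt V) * exp (- k\<^sup>2 / (2 * V)))"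
      using elim \<open>3 * V + k\<^sup>2 \<noteq> 0\<close> by auto
    ultimately show ?case
      by (simp only:)
  qed
  ultimately show "((\<lambda>V. bs_vega k V / ?g' V) \<longlongrightarrow> exp (k / 2) / (sqrt (2 * pi) * k\<^sup>2)) (at_right 0)"
    by (simp add: tendsto_cong)
qed

section \<open>Inverting the logarithmic price relation\<close>

text \<open>With \<open>h = 3/2 * ln y + \<delta>\<close> one has \<open>L = y + h\<close> and
  \<open>L * (L / y - 1) = h + h^2 / y\<close>. The last term vanishes because \<open>h\<close> is
  of logarithmic size, and \<open>ln y\<close> may be replaced by \<open>ln L\<close> because
  \<open>L / y\<close> tends to 1.\<close>

lemma log_expansion_inverse:
  fixes y L \<delta> :: "real \<Rightarrow> real"
  assumes y: "filterlim y at_top F" and \<delta>: "(\<delta> \<longlongrightarrow> d) F"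
    and L: "\<forall>\<^sub>F t in F. L t = y t + 3 / 2 * ln (y t) + \<delta> t"
  shows "((\<lambda>t. L t * (L t / y t - 1) - 3 / 2 * ln (L t) - d) \<longlongrightarrow> 0) F"
proof -
  have lim: "((\<lambda>y::real. ln y ^ 2 / y) \<longlongrightarrow> 0) at_top" "((\<lambda>y::real. ln y / y) \<longlongrightarrow> 0) at_top"
    "((\<lambda>y::real. 1 / y) \<longlongrightarrow> 0) at_top"
    by real_asymp+
  note lim = lim[THEN filterlim_compose, OF y]
  have r: "((\<lambda>t. 1 + 3 / 2 * (ln (y t) / y t) + \<delta> t * (1 / y t)) \<longlongrightarrow> 1 + 3 / 2 * 0 + d * 0) F"
    by (intro tendsto_intros lim \<delta>)
  have "((\<lambda>t. ln (1 + 3 / 2 * (ln (y t) / y t) + \<delta> t * (1 / y t))) \<longlongrightarrow> ln (1 + 3 / 2 * 0 + d * 0)) F"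
    by (rule tendsto_ln[OF r]) simp
  then have "((\<lambda>t. (\<delta> t - d) + (9 / 4 * (ln (y t) ^ 2 / y t) + 3 * \<delta> t * (ln (y t) / y t) + \<delta> t ^ 2 * (1 / y t))
      - 3 / 2 * ln (1 + 3 / 2 * (ln (y t) / y t) + \<delta> t * (1 / y t))) \<longlongrightarrow>
      (d - d) + (9 / 4 * 0 + 3 * d * 0 + d ^ 2 * 0) - 3 / 2 * ln (1 + 3 / 2 * 0 + d * 0)) F"
    by (intro tendsto_intros lim \<delta>) simp
  moreover have "\<forall>\<^sub>F t in F. (\<delta> t - d) + (9 / 4 * (ln (y t) ^ 2 / y t) + 3 * \<delta> t * (ln (y t) / y t) + \<delta> t ^ 2 * (1 / y t))
      - 3 / 2 * ln (1 + 3 / 2 * (ln (y t) / y t) + \<delta> t * (1 / y t)) =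
      L t * (L t / y t - 1) - 3 / 2 * ln (L t) - d"
  proof -
    have "\<forall>\<^sub>F t in F. 0 < 1 + 3 / 2 * (ln (y t) / y t) + \<delta> t * (1 / y t)"
      using order_tendstoD(1)[OF r, of 0] by simp
    moreover have "\<forall>\<^sub>F t in F. 0 < y t"
      using y by (simp add: filterlim_at_top_dense)
    ultimately show ?thesis using L
    proof eventually_elim
      case (elim t)
      let ?q = "1 + 3 / 2 * (ln (y t) / y t) + \<delta> t * (1 / y t)" and ?h = "3 / 2 * ln (y t) + \<delta> t"
      have "y t * ?q = y t + 3 / 2 * ln (y t) + \<delta> t"
        using elim(2) by (simp add: distrib_left)
      with elim(3) have Lq: "L t = y t * ?q" by simp
      have "ln (L t) = ln (y t) + ln ?q"
        unfolding Lq using elim by (intro ln_mult_pos)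
      moreover have "L t * (L t / y t - 1) = ?h + ?h ^ 2 / y t"
      proof -
        have "(u + h) * ((u + h) / u - 1) = h + h ^ 2 / u" if "u \<noteq> 0" for u h :: real
          using that by (simp add: field_simps power2_eq_square)
        from this[of "y t" ?h] elim show ?thesis by (simp add: add.assoc)
      qed
      moreover have "?h ^ 2 / y t = 9 / 4 * (ln (y t) ^ 2 / y t) + 3 * \<delta> t * (ln (y t) / y t) + \<delta> t ^ 2 * (1 / y t)"
        using elim by (simp add: field_simps power2_eq_square)
      ultimately show ?case by (simp add: algebra_simps)
    qed
  qed
  ultimately have "((\<lambda>t. L t * (L t / y t - 1) - 3 / 2 * ln (L t) - d) \<longlongrightarrow>
      (d - d) + (9 / 4 * 0 + 3 * d * 0 + d ^ 2 * 0) - 3 / 2 * ln (1 + 3 / 2 * 0 + d * 0)) F"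
    by (rule Lim_transform_eventually)
  then show ?thesis by simp
qed

text \<open>Applied with \<open>y = k^2 / (2 * V)\<close>, for which \<open>L / y\<close> is
  precisely \<open>V t / V0 t k\<close>; the logarithm of the price asymptotics then has the shape
  that \<open>log_expansion_inverse\<close> inverts.\<close>

lemma bs_implied_variance_expansion:
  fixes C V :: "real \<Rightarrow> real"
  assumes k: "0 < k" and a: "0 < a"
    and C: "((\<lambda>t. C t / t) \<longlongrightarrow> a) (at_right 0)"
    and V: "\<And>t. V t = (THE V. 0 < V \<and> C t = bs_call k V)"
  defines "L \<equiv> \<lambda>t. ln (1 / t)"
  shows "((\<lambda>t. L t * (V t / V0 t k - 1) - ln (4 * sqrt pi * a * exp (- k / 2) / k * L t powr (3 / 2))) \<longlongrightarrow> 0) (at_right 0)"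
proof -
  have pos: "\<forall>\<^sub>F t in at_right 0. 0 < (t::real)"
    by (simp add: eventually_at_right_less)
  have C_pos: "\<forall>\<^sub>F t in at_right 0. 0 < C t"
    using pos order_tendstoD(1)[OF C a] by eventually_elim (simp add: zero_less_divide_iff)
  have C0: "(C \<longlongrightarrow> 0) (at_right 0)"
  proof -
    have "((\<lambda>t. C t / t * t) \<longlongrightarrow> a * 0) (at_right 0)"
      by (intro tendsto_intros C)
    moreover have "\<forall>\<^sub>F t in at_right 0. C t / t * t = C t"
      using pos by eventually_elim simp
    ultimately show ?thesis by (simp add: tendsto_cong)
  qed
  have V_eq: "0 < V t \<and> C t = bs_call k (V t)" if "0 < W" "0 < C t" "C t < bs_call k W" for t W
    unfolding V using bs_call_inverse[OF k that] by (rule theI')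
  \<comment> \<open>The reference variance 1 is arbitrary: prices tend to 0, so eventually they lie
    below any fixed Black-Scholes price.\<close>
  have V_ev: "\<forall>\<^sub>F t in at_right 0. 0 < V t \<and> C t = bs_call k (V t)"
    using C_pos order_tendstoD(2)[OF C0 bs_call_pos[OF k zero_less_one]]
    by eventually_elim (rule V_eq[OF zero_less_one])
  have V_lim: "filterlim V (at_right 0) (at_right 0)"
  proof -
    have "(V \<longlongrightarrow> 0) (at_right 0)"
    proof (rule order_tendstoI)
      fix W :: real assume W: "0 < W"
      show "\<forall>\<^sub>F t in at_right 0. V t < W"
        using V_ev order_tendstoD(2)[OF C0 bs_call_pos[OF k W]]
      proof eventually_elim
        case (elim t)
        then show ?case
          using bs_call_strict_mono[of W "V t" k] W by (cases "W = V t") (auto simp: not_less_iff_gr_or_eq intro: ccontr)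
      qed
    next
      fix W :: real assume "W < 0"
      then show "\<forall>\<^sub>F t in at_right 0. W < V t"
        using V_ev by (auto elim!: eventually_mono)
    qed
    moreover have "\<forall>\<^sub>F t in at_right 0. 0 < V t"
      using V_ev by eventually_elim simp
    ultimately show ?thesis
      by (auto simp: filterlim_at elim: eventually_mono)
  qed
  define y where "y t = k\<^sup>2 / (2 * V t)" for t
  let ?c = "exp (k / 2) / (sqrt (2 * pi) * k\<^sup>2)"
  let ?A = "\<lambda>V. V * sqrt V * exp (- k\<^sup>2 / (2 * V))"
  have c: "0 < ?c" using k by simp
  \<comment> \<open>Collects the logarithms of the two convergent ratios and the constant that
    arises when \<open>3/2 * ln V\<close> is rewritten in terms of \<open>ln y\<close>.\<close>
  define \<delta> where "\<delta> t = ln (C t / t) - ln (bs_call k (V t) / ?A (V t)) - 3 / 2 * ln (k\<^sup>2 / 2)" for t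
  let ?d = "ln a - ln ?c - 3 / 2 * ln (k\<^sup>2 / 2)"
  have \<delta>: "(\<delta> \<longlongrightarrow> ?d) (at_right 0)"
    unfolding \<delta>_def using a c
    by (intro tendsto_intros C filterlim_compose[OF bs_call_asymp[OF k] V_lim]) auto
  have y_lim: "filterlim y at_top (at_right 0)"
  proof -
    have "filterlim (\<lambda>V. k\<^sup>2 / (2 * V)) at_top (at_right 0)"
      using k by real_asymp
    then show ?thesis
      unfolding y_def using V_lim by (rule filterlim_compose)
  qed
  have "\<forall>\<^sub>F t in at_right 0. L t = y t + 3 / 2 * ln (y t) + \<delta> t"
    using V_ev C_pos pos
  proof eventually_elim
    case (elim t)
    have k2: "0 < k\<^sup>2" using k by simp
    have "ln (C t / t) = ln (C t) + L t"
      using elim by (simp add: ln_div L_def)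
    moreover have "ln (bs_call k (V t) / ?A (V t)) = ln (C t) - ln (?A (V t))"
      using elim by (simp add: ln_div)
    moreover have "ln (?A (V t)) = 3 / 2 * ln (V t) - y t"
      using elim by (simp add: ln_mult ln_sqrt y_def)
    moreover have "ln (y t) = ln (k\<^sup>2 / 2) - ln (V t)"
    proof -
      have "y t = (k\<^sup>2 / 2) / V t" by (simp add: y_def)
      moreover have "ln ((k\<^sup>2 / 2) / V t) = ln (k\<^sup>2 / 2) - ln (V t)"
        using elim k2 by (intro ln_divide_pos) auto
      ultimately show ?thesis by (simp only:)
    qed
    ultimately show ?case by (simp add: \<delta>_def algebra_simps)
  qed
  from log_expansion_inverse[OF y_lim \<delta> this]
  have "((\<lambda>t. L t * (L t / y t - 1) - 3 / 2 * ln (L t) - ?d) \<longlongrightarrow> 0) (at_right 0)" .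
  moreover have "\<forall>\<^sub>F t in at_right 0. L t * (L t / y t - 1) - 3 / 2 * ln (L t) - ?d =
      L t * (V t / V0 t k - 1) - ln (4 * sqrt pi * a * exp (- k / 2) / k * L t powr (3 / 2))"
  proof -
    \<comment> \<open>Origin of the constant in \<open>V1\<close>:
      \<open>sqrt (2 * pi) * k^2 * (2 / k^2) powr (3/2) = 4 * sqrt pi / k\<close>.\<close>
    have d_eq: "?d = ln (4 * sqrt pi * a * exp (- k / 2) / k)"
    proof -
      have s2: "ln (sqrt 2) = ln 2 / 2" "ln (sqrt pi) = ln pi / 2" "ln 4 = 2 * ln (2::real)"
        using ln_realpow[of 2 2] by (simp_all add: ln_sqrt)
      show ?thesis
        using k a by (simp add: ln_div ln_mult ln_realpow real_sqrt_mult s2)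
          (simp add: diff_divide_distrib)
    qed
    have "\<forall>\<^sub>F t in at_right 0. 0 < L t"
      unfolding L_def by real_asymp
    then show ?thesis
      using V_ev
    proof eventually_elim
      case (elim t)
      have "L t / y t = V t / V0 t k"
        using elim k by (simp add: y_def V0_def L_def field_simps)
      moreover have "ln (4 * sqrt pi * a * exp (- k / 2) / k * L t powr (3 / 2)) =
          ln (4 * sqrt pi * a * exp (- k / 2) / k) + 3 / 2 * ln (L t)"
        using elim k a by (subst ln_mult_pos) (auto simp: ln_powr)
      ultimately show ?case by (simp only: d_eq)
    qed
  qed
  ultimately show ?thesis
    by (rule Lim_transform_eventually)
qed

theorem theorem2p3:
  fixes M :: "'a measure" and X S :: "real \<Rightarrow> 'a \<Rightarrow> real"
    and \<sigma> b S0 k :: real and \<nu> :: "real measure" and g :: "real \<Rightarrow> real"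
  assumes triplet: "has_levy_triplet M X (\<sigma>\<^sup>2) b \<nu>"
    and S0_pos: "0 < S0"
    and S_def: "\<And>t \<omega>. S t \<omega> = S0 * exp (X t \<omega>)"
    and exp_moment: "(\<integral>\<^sup>+x\<in>{x. 1 < \<bar>x\<bar>}. ennreal (exp x) \<partial>\<nu>) < \<infinity>"
    and martingale:
      "b + 1 / 2 * \<sigma>\<^sup>2 + (LINT x|\<nu>. exp x - 1 - x * indicator {-1..1} x) = 0"
    and density: "\<nu> = density lborel (\<lambda>x. ennreal (g x))"
    and density_pos: "\<And>x. x \<noteq> 0 \<Longrightarrow> 0 < g x"
    and density_differentiable: "g differentiable_on (- {0})"
    and density_C1: "continuous_on (- {0}) (deriv g)"
    and density_bounded: "\<And>\<epsilon>. 0 < \<epsilon> \<Longrightarrow> bdd_above (g ` {x. \<epsilon> < \<bar>x\<bar>})"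
    and k_pos: "0 < k"
  shows "\<exists>R. R \<in> o[at_right 0](\<lambda>t. 1 / ln (1 / t)) \<and>
    (\<forall>\<^sub>F t in at_right 0.
       implied_variance M S0 S t k = V0 t k * (1 + V1 \<nu> t k + R t))"
proof -
  have nu: "levy_measure \<nu>"
    using triplet by (rule has_levy_tripletD)
  \<comment> \<open>The density is continuous except possibly at the single point 0, which is enough
    for measurability.\<close>
  have g_meas: "g \<in> borel_measurable borel"
    using differentiable_imp_continuous_on[OF density_differentiable]
    by (intro borel_measurable_continuous_countable_exceptions[of "{0}"]) auto
  have weight: "0 < (LINT x|\<nu>. levy_weight x)"
    unfolding density
    by (rule integral_density_pos[where c=0 and d=1])
       (use integrable_levy_weight[OF nu] g_meas density_pos in
         \<open>auto simp: density levy_weight_nonneg levy_weight_pos\<close>)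
  have a0_pos: "0 < a0 \<nu> k"
    unfolding a0_def density
    by (rule integral_density_pos[where c=k and d="k + 1"])
       (use integrable_call_payoff[OF nu exp_moment k_pos] g_meas density_pos k_pos in \<open>auto simp: density\<close>)
  have mart: "b + \<sigma>\<^sup>2 / 2 + (LINT x|\<nu>. exp x - 1 - x * indicator {-1..1} x) = 0"
    using martingale by simp
  define C where "C t = (LINT \<omega>|M. max (exp (X t \<omega>) - exp k) 0)" for t
  have C: "((\<lambda>t. C t / t) \<longlongrightarrow> a0 \<nu> k) (at_right 0)"
    unfolding C_def by (rule levy_call_price_asymp[OF triplet exp_moment mart weight k_pos])
  define V where "V t = implied_variance M S0 S t k" for t
  \<comment> \<open>The payoff is homogeneous in the spot, so \<open>S0\<close> cancels and the
    price depends on \<open>X t\<close> alone.\<close>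
  have V: "V t = (THE V. 0 < V \<and> C t = bs_call k V)" for t
  proof -
    have "max (S t \<omega> - S0 * exp k) 0 = S0 * max (exp (X t \<omega>) - exp k) 0" for \<omega>
      using S0_pos by (simp add: S_def max_mult_distrib_left right_diff_distrib)
    then have "1 / S0 * (LINT \<omega>|M. max (S t \<omega> - S0 * exp k) 0) = C t"
      using S0_pos by (simp add: C_def)
    then show ?thesis
      by (simp only: V_def implied_variance_def)
  qed
  \<comment> \<open>The remainder is defined by the desired identity; the whole content is the claim
    that \<open>ln (1 / t) * R t\<close> tends to 0.\<close>
  define R where "R t = V t / V0 t k - 1 - V1 \<nu> t k" for t
  have L: "\<forall>\<^sub>F t in at_right 0. 0 < ln (1 / t :: real)"
    by real_asymp
  have "((\<lambda>t. R t / (1 / ln (1 / t))) \<longlongrightarrow> 0) (at_right 0)"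
  proof (rule Lim_transform_eventually[OF bs_implied_variance_expansion[OF k_pos a0_pos C V]])
    show "\<forall>\<^sub>F t in at_right 0. ln (1 / t) * (V t / V0 t k - 1) -
        ln (4 * sqrt pi * a0 \<nu> k * exp (- k / 2) / k * ln (1 / t) powr (3 / 2)) =
        R t / (1 / ln (1 / t))"
      using L by eventually_elim (simp add: R_def V1_def right_diff_distrib mult.commute)
  qed
  then have "R \<in> o[at_right 0](\<lambda>t. 1 / ln (1 / t))"
    by (rule smalloI_tendsto) (use L in \<open>auto elim: eventually_mono\<close>)
  moreover have "\<forall>\<^sub>F t in at_right 0. implied_variance M S0 S t k = V0 t k * (1 + V1 \<nu> t k + R t)"
    using L
  proof eventually_elim
    case (elim t)
    then have "V0 t k \<noteq> 0" using k_pos by (simp add: V0_def)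
    then show ?case by (simp add: R_def V_def)
  qed
  ultimately show ?thesis by blast
qed

end
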